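(* Let $H$ be a finite-dimensional unimodular Hopf algebra over a field $\Bbbk$, and let $N$ be the subalgebra of $H$ generated by all commutators $\{a,b\}$, $a,b\in H$ (it is a left coideal subalgebra of $H$). Then $N$ is normal, i.e. stable under the left adjoint action of $H$: $h_1xS(h_2)\in N$ for all $h\in H$, $x\in N$.
   Context: Sweedler notation: $\Delta(a)=a_1\otimes a_2$; $S$ is the antipode. $H$ is unimodular if its left integrals are also right integrals. A right integral of $H^*$ is $\lambda\in H^*$ with $\lambda(a_1)a_2=\lambda(a)1$ for all $a\in H$. The distinguished group-like element $g\in H$ is determined by $a_1\lambda(a_2)=\lambda(a)g$ for all $a\in H$ (for $\lambda$ a nonzero right integral of $H^*$); for unimodular $H$ one has $S^4(a)=gag^{-1}$. The commutator of $a,b\in H$ is $\{a,b\}:=a_1S^2(b_1)S(a_2)S^{-1}(b_2)g^{-1}$. A left coideal subalgebra of $H$ is a subalgebra $N$ with $\Delta(N)\subseteq H\otimes N$. *)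

theory Defs
  imports Complex_Main "HOL-Library.Poly_Mapping"
begin

section \<open>Formal linear combinations\<close>

text \<open>The free vector space on a type of indices is the type of finitely supported functions
  \<^typ>\<open>'i \<Rightarrow>\<^sub>0 'k\<close>, with pointwise scalar multiplication.\<close>

definition formal_scale :: "'k::field \<Rightarrow> ('i \<Rightarrow>\<^sub>0 'k) \<Rightarrow> ('i \<Rightarrow>\<^sub>0 'k)"
  where "formal_scale c t = Poly_Mapping.map ((*) c) t"

lemma lookup_formal_scale [simp]:
  "Poly_Mapping.lookup (formal_scale c t) i = c * Poly_Mapping.lookup t i"
  by (simp add: formal_scale_def map.rep_eq when_def)

interpretation formal: vector_space "formal_scale :: 'k::field \<Rightarrow> ('i \<Rightarrow>\<^sub>0 'k) \<Rightarrow> ('i \<Rightarrow>\<^sub>0 'k)"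
  by unfold_locales (auto intro!: poly_mapping_eqI simp: lookup_add algebra_simps)

definition linear_extension ::
    "('k::field \<Rightarrow> 'v \<Rightarrow> 'v) \<Rightarrow> ('i \<Rightarrow> 'v::ab_group_add) \<Rightarrow> ('i \<Rightarrow>\<^sub>0 'k) \<Rightarrow> 'v"
  where "linear_extension sc F t =
    (\<Sum>i\<in>Poly_Mapping.keys t. sc (Poly_Mapping.lookup t i) (F i))"


section \<open>Tensor powers of a vector space\<close>

text \<open>The tensor square (cube) is the free vector space on pairs (triples) of vectors modulo
  the subspace spanned by the relations of additivity and homogeneity in every slot. A slot is
  the map inserting a vector in one position, the other positions being kept fixed. A tensor is
  a coset of that subspace.\<close>

definition slot_relations :: "('k::field \<Rightarrow> 'h \<Rightarrow> 'h::ab_group_add) \<Rightarrow> ('h \<Rightarrow> 'i) set \<Rightarrow> ('i \<Rightarrow>\<^sub>0 'k) set"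
  where "slot_relations sc U =
    {Poly_Mapping.single (u (x + y)) 1 - Poly_Mapping.single (u x) 1
       - Poly_Mapping.single (u y) 1 | u x y. u \<in> U} \<union>
    {Poly_Mapping.single (u (sc c x)) 1 - Poly_Mapping.single (u x) c | u c x. u \<in> U}"

definition tensor_class :: "('k::field \<Rightarrow> 'h \<Rightarrow> 'h::ab_group_add) \<Rightarrow> ('h \<Rightarrow> 'i) set \<Rightarrow> ('i \<Rightarrow>\<^sub>0 'k) \<Rightarrow> ('i \<Rightarrow>\<^sub>0 'k) set"
  where "tensor_class sc U t = {s. s - t \<in> formal.span (slot_relations sc U)}"

definition slots2 :: "('h \<Rightarrow> 'h \<times> 'h) set"
  where "slots2 = {\<lambda>x. (x, y) | y. True} \<union> {\<lambda>x. (y, x) | y. True}"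

definition slots3 :: "('h \<Rightarrow> 'h \<times> 'h \<times> 'h) set"
  where "slots3 = {\<lambda>x. (x, y, z) | y z. True} \<union> {\<lambda>x. (y, x, z) | y z. True}
    \<union> {\<lambda>x. (y, z, x) | y z. True}"

abbreviation tensor2 :: "('k::field \<Rightarrow> 'h \<Rightarrow> 'h::ab_group_add) \<Rightarrow> ('h \<times> 'h \<Rightarrow>\<^sub>0 'k) \<Rightarrow> ('h \<times> 'h \<Rightarrow>\<^sub>0 'k) set"
  where "tensor2 sc \<equiv> tensor_class sc slots2"

abbreviation tensor3 :: "('k::field \<Rightarrow> 'h \<Rightarrow> 'h::ab_group_add) \<Rightarrow> ('h \<times> 'h \<times> 'h \<Rightarrow>\<^sub>0 'k) \<Rightarrow> ('h \<times> 'h \<times> 'h \<Rightarrow>\<^sub>0 'k) set"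
  where "tensor3 sc \<equiv> tensor_class sc slots3"

definition representative :: "('i \<Rightarrow>\<^sub>0 'k::field) set \<Rightarrow> ('i \<Rightarrow>\<^sub>0 'k)"
  where "representative T = (SOME t. t \<in> T)"

text \<open>Sweedler notation: if the coproduct of \<open>a\<close> is the tensor \<open>D a\<close>, then
  \<open>sweedler sc D a F\<close> is the expression \<open>F(a\<^sub>1, a\<^sub>2)\<close>, with values in a vector space with
  scalar multiplication \<open>sc\<close>. It is independent of the representative of \<open>D a\<close> whenever \<open>F\<close>
  is bilinear; see \<open>linear_extension_tensor2_cong\<close> below.\<close>

definition sweedler ::
    "('k::field \<Rightarrow> 'v \<Rightarrow> 'v) \<Rightarrow> ('h \<Rightarrow> ('h \<times> 'h \<Rightarrow>\<^sub>0 'k) set) \<Rightarrow> 'h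
      \<Rightarrow> ('h \<Rightarrow> 'h \<Rightarrow> 'v::ab_group_add) \<Rightarrow> 'v"
  where "sweedler sc D a F = linear_extension sc (\<lambda>(x, y). F x y) (representative (D a))"

lemma linear_extension_superset:
  assumes "vector_space sc" "finite A" "Poly_Mapping.keys t \<subseteq> A"
  shows "linear_extension sc F t = (\<Sum>i\<in>A. sc (Poly_Mapping.lookup t i) (F i))"
proof -
  interpret vector_space sc by fact
  show ?thesis
    unfolding linear_extension_def using assms(2,3)
    by (intro sum.mono_neutral_left) (auto simp: in_keys_iff)
qed

lemma linear_linear_extension:
  assumes "vector_space sc"
  shows "Vector_Spaces.linear formal_scale sc (linear_extension sc F)"
proof -
  interpret vector_space sc by fact
  have add: "linear_extension sc F (s + t) = linear_extension sc F s + linear_extension sc F t"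
    for s t
  proof -
    let ?A = "Poly_Mapping.keys s \<union> Poly_Mapping.keys t"
    have "Poly_Mapping.keys (s + t) \<subseteq> ?A" by (rule Poly_Mapping.keys_add)
    then show ?thesis
      by (simp add: linear_extension_superset[OF assms, of ?A] lookup_add
          scale_left_distrib sum.distrib)
  qed
  have sc: "linear_extension sc F (formal_scale c t) = sc c (linear_extension sc F t)" for c t
  proof -
    have "Poly_Mapping.keys (formal_scale c t) \<subseteq> Poly_Mapping.keys t"
      by (auto simp: in_keys_iff)
    then show ?thesis
      by (simp add: linear_extension_superset[OF assms, of "Poly_Mapping.keys t"]
          scale_sum_right)
  qed
  show ?thesis
    by unfold_locales (simp_all add: add sc)
qed

lemma linear_extension_single:
  assumes "vector_space sc"
  shows "linear_extension sc F (Poly_Mapping.single i c) = sc c (F i)"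
  using linear_extension_superset[OF assms, of "{i}"] by simp

lemma (in vector_space) linear_extension_tensor2_cong:
  assumes "vector_space sc"
    and l: "\<And>y. Vector_Spaces.linear scale sc (\<lambda>x. F x y)"
    and r: "\<And>x. Vector_Spaces.linear scale sc (\<lambda>y. F x y)"
    and "s \<in> tensor2 scale t"
  shows "linear_extension sc (\<lambda>(x, y). F x y) s = linear_extension sc (\<lambda>(x, y). F x y) t"
proof -
  interpret L: Vector_Spaces.linear formal_scale sc "linear_extension sc (\<lambda>(x, y). F x y)"
    by (rule linear_linear_extension) fact
  note h = Vector_Spaces.linear.axioms(3)
  have "linear_extension sc (\<lambda>(x, y). F x y) d = 0" if "d \<in> slot_relations scale slots2" for d
    using that unfolding slot_relations_def slots2_def
    by (auto simp: L.diff linear_extension_single[OF assms(1)]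
        module_hom.add[OF h[OF l]] module_hom.add[OF h[OF r]]
        module_hom.scale[OF h[OF l]] module_hom.scale[OF h[OF r]])
  then have "linear_extension sc (\<lambda>(x, y). F x y) d = 0"
    if "d \<in> formal.span (slot_relations scale slots2)" for d
    using L.eq_0_on_span that by blast
  from this[of "s - t"] assms(4) show ?thesis
    by (simp add: tensor_class_def L.diff)
qed


section \<open>Hopf algebras\<close>

text \<open>Associative unital algebras over a field. The requirement \<open>0 \<noteq> 1\<close> in \<^class>\<open>ring_1\<close> is no
  restriction for Hopf algebras, because the counit maps \<open>1\<close> to \<open>1\<close>.\<close>

locale unital_algebra = vector_space scale
  for scale :: "'k::field \<Rightarrow> 'h::ring_1 \<Rightarrow> 'h" (infixr \<open>*s\<close> 75) +
  assumes scale_mult_left: "(c *s a) * b = c *s (a * b)"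
    and mult_scale_right: "a * (c *s b) = c *s (a * b)"
begin

definition subalgebra :: "'h set \<Rightarrow> bool"
  where "subalgebra A \<longleftrightarrow> subspace A \<and> 1 \<in> A \<and> (\<forall>a\<in>A. \<forall>b\<in>A. a * b \<in> A)"

text \<open>The product \<open>(x \<otimes> y) (x' \<otimes> y') = x x' \<otimes> y y'\<close>, on formal sums.\<close>

definition tensor_mult :: "('h \<times> 'h \<Rightarrow>\<^sub>0 'k) \<Rightarrow> ('h \<times> 'h \<Rightarrow>\<^sub>0 'k) \<Rightarrow> ('h \<times> 'h \<Rightarrow>\<^sub>0 'k)"
  where "tensor_mult s t =
    linear_extension formal_scale (\<lambda>(x, y).
      linear_extension formal_scale (\<lambda>(x', y'). Poly_Mapping.single (x * x', y * y') 1) t) s"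

end

text \<open>The comultiplication \<open>\<Delta>\<close> takes values in cosets of formal sums, i.e. in the tensor square;
  the equations for it do not depend on the choice of representatives.\<close>

locale hopf_algebra = unital_algebra scale
  for scale :: "'k::field \<Rightarrow> 'h::ring_1 \<Rightarrow> 'h" (infixr \<open>*s\<close> 75) +
  fixes \<Delta> :: "'h \<Rightarrow> ('h \<times> 'h \<Rightarrow>\<^sub>0 'k) set"
    and \<epsilon> :: "'h \<Rightarrow> 'k"
    and S :: "'h \<Rightarrow> 'h"
  assumes comult_tensor: "\<Delta> a \<in> range (tensor2 scale)"
    and comult_add: "\<Delta> (a + b) = tensor2 scale (representative (\<Delta> a) + representative (\<Delta> b))"
    and comult_scale: "\<Delta> (c *s a) = tensor2 scale (formal_scale c (representative (\<Delta> a)))"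
    and comult_mult: "\<Delta> (a * b) = tensor2 scale (tensor_mult (representative (\<Delta> a)) (representative (\<Delta> b)))"
    and comult_one: "\<Delta> 1 = tensor2 scale (Poly_Mapping.single (1, 1) 1)"
    and coassoc:
      "tensor3 scale (sweedler formal_scale \<Delta> a (\<lambda>x y.
          sweedler formal_scale \<Delta> x (\<lambda>p q. Poly_Mapping.single (p, q, y) 1))) =
       tensor3 scale (sweedler formal_scale \<Delta> a (\<lambda>x y.
          sweedler formal_scale \<Delta> y (\<lambda>p q. Poly_Mapping.single (x, p, q) 1)))"
    and counit_linear: "Vector_Spaces.linear scale (*) \<epsilon>"
    and counit_mult: "\<epsilon> (a * b) = \<epsilon> a * \<epsilon> b"
    and counit_one: "\<epsilon> 1 = 1"
    and counit_left: "sweedler scale \<Delta> a (\<lambda>x y. \<epsilon> x *s y) = a"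
    and counit_right: "sweedler scale \<Delta> a (\<lambda>x y. \<epsilon> y *s x) = a"
    and antipode_linear: "Vector_Spaces.linear scale scale S"
    and antipode_left: "sweedler scale \<Delta> a (\<lambda>x y. S x * y) = \<epsilon> a *s 1"
    and antipode_right: "sweedler scale \<Delta> a (\<lambda>x y. x * S y) = \<epsilon> a *s 1"
begin

definition left_integral :: "'h \<Rightarrow> bool"
  where "left_integral \<Lambda> \<longleftrightarrow> (\<forall>h. h * \<Lambda> = \<epsilon> h *s \<Lambda>)"

definition right_integral :: "'h \<Rightarrow> bool"
  where "right_integral \<Lambda> \<longleftrightarrow> (\<forall>h. \<Lambda> * h = \<epsilon> h *s \<Lambda>)"

definition unimodular :: bool
  where "unimodular \<longleftrightarrow> (\<forall>\<Lambda>. left_integral \<Lambda> \<longrightarrow> right_integral \<Lambda>)"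

definition dual_right_integral :: "('h \<Rightarrow> 'k) \<Rightarrow> bool"
  where "dual_right_integral l \<longleftrightarrow> Vector_Spaces.linear scale (*) l \<and>
    (\<forall>a. sweedler scale \<Delta> a (\<lambda>x y. l x *s y) = l a *s 1)"

text \<open>For finite-dimensional Hopf algebras, nonzero right integrals of the dual exist and are
  unique up to a scalar, so this is the distinguished group-like element.\<close>

definition distinguished_grouplike :: 'h
  where "distinguished_grouplike =
    (THE g. \<exists>l. dual_right_integral l \<and> (\<exists>a. l a \<noteq> 0) \<and>
      (\<forall>a. sweedler scale \<Delta> a (\<lambda>x y. l y *s x) = l a *s g))"

definition unit_inverse :: "'h \<Rightarrow> 'h"
  where "unit_inverse u = (THE v. u * v = 1 \<and> v * u = 1)"

text \<open>\<open>inv S\<close> is the compositional inverse of the antipode, which is bijective in finite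
  dimension.\<close>

definition commutator :: "'h \<Rightarrow> 'h \<Rightarrow> 'h"
  where "commutator a b =
    sweedler scale \<Delta> a (\<lambda>a1 a2. sweedler scale \<Delta> b (\<lambda>b1 b2.
      a1 * S (S b1) * S a2 * inv S b2 * unit_inverse distinguished_grouplike))"

definition commutator_subalgebra :: "'h set"
  where "commutator_subalgebra = subalgebra hull {commutator a b | a b. True}"

definition adjoint_action :: "'h \<Rightarrow> 'h \<Rightarrow> 'h"
  where "adjoint_action h x = sweedler scale \<Delta> h (\<lambda>h1 h2. h1 * x * S h2)"

definition normal :: "'h set \<Rightarrow> bool"
  where "normal N \<longleftrightarrow> (\<forall>h. \<forall>x\<in>N. adjoint_action h x \<in> N)"

end

end

theory Submission
  imports Defs
begin

text \<open>For elements of a group, \<open>h [a, b] h\<inverse> = [h a, b] [b, h]\<close>. The same computation works in every Hopf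
  algebra for the plain commutator \<open>[a, b] = a\<^sub>1 b\<^sub>1 S(a\<^sub>2) S(b\<^sub>2)\<close>: writing \<open>h \<rhd> x = h\<^sub>1 x S(h\<^sub>2)\<close> for the
  adjoint action, \<open>h \<rhd> [a, b] = [h\<^sub>1 a, b\<^sub>1] [b\<^sub>2, h\<^sub>2]\<close> (\<open>adjoint_plain_commutator\<close>). Since
  \<open>h \<rhd> (x y) = (h\<^sub>1 \<rhd> x) (h\<^sub>2 \<rhd> y)\<close>, the elements whose whole adjoint orbit lies in a given subalgebra form a
  subalgebra, and it suffices to treat generators.

  It remains to compare \<open>{a, b}\<close> with plain commutators. By unimodularity \<open>S\<^sup>4(z) g = g z\<close>, and this turns the
  definition into \<open>{a, b} = g\<inverse> [g a, S\<^sup>2(b)]\<close> (\<open>commutator_eq_plain_commutator\<close>). In particular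
  \<open>{1, 1} = g\<inverse>\<close> lies in \<open>N\<close>; so does \<open>g\<close>, because a finite-dimensional subalgebra contains the
  inverse of each of its elements that is invertible in \<open>H\<close>. Hence \<open>N\<close> contains every plain commutator. Together with
  \<open>h \<rhd> g\<inverse> = g\<inverse> [g, h]\<close> this shows that the adjoint orbits of \<open>g\<inverse>\<close> and of the plain commutators stay in
  \<open>N\<close>, hence also those of the generators \<open>{a, b}\<close>.

  The formula for \<open>S\<^sup>4\<close>, the existence of \<open>g\<close> and the bijectivity of \<open>S\<close> come from the theory of integrals.
  A trace formula produces a nonzero right integral \<open>l\<close> of the dual (\<open>dual_right_integral_exists\<close>). The form
  \<open>(h, a) \<mapsto> l (S h * a)\<close> is nondegenerate (\<open>integral_nondegenerate_antipode\<close>), which gives bijectivity of \<open>S\<close>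
  and uniqueness of \<open>l\<close> up to a scalar; uniqueness in turn gives \<open>g\<close>. For unimodular \<open>H\<close> the Nakayama
  automorphism of \<open>l\<close> is \<open>S\<^sup>2\<close> (\<open>integral_nakayama\<close>), while \<open>l (S a * g)\<close> is again an integral, hence a
  multiple of \<open>l a\<close>. Moving factors around in \<open>l (S y * S x * g)\<close> with these two rules yields
  \<open>S\<^sup>4(z) g = g z\<close>.\<close>

section \<open>Sweedler calculus\<close>

lemma linear_extension_linear_extension:
  assumes "vector_space sc"
  shows "linear_extension sc F (linear_extension formal_scale G t) =
    linear_extension sc (\<lambda>i. linear_extension sc F (G i)) t"
proof -
  interpret L: Vector_Spaces.linear formal_scale sc "linear_extension sc F"
    by (rule linear_linear_extension[OF assms])
  show ?thesis
    unfolding linear_extension_def[of formal_scale G] linear_extension_def[of sc "\<lambda>i. linear_extension sc F (G i)"]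
    by (simp add: L.sum L.scale)
qed

text \<open>Coassociativity is an equation between cosets in the tensor cube; this is what makes it
  usable under an arbitrary trilinear expression.\<close>

lemma (in vector_space) linear_extension_tensor3_cong:
  assumes "vector_space sc"
    and l1: "\<And>y z. Vector_Spaces.linear scale sc (\<lambda>x. F x y z)"
    and l2: "\<And>x z. Vector_Spaces.linear scale sc (\<lambda>y. F x y z)"
    and l3: "\<And>x y. Vector_Spaces.linear scale sc (\<lambda>z. F x y z)"
    and "tensor3 scale s = tensor3 scale t"
  shows "linear_extension sc (\<lambda>(x, y, z). F x y z) s = linear_extension sc (\<lambda>(x, y, z). F x y z) t"
proof -
  interpret L: Vector_Spaces.linear formal_scale sc "linear_extension sc (\<lambda>(x, y, z). F x y z)"
    by (rule linear_linear_extension) fact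
  note h = Vector_Spaces.linear.axioms(3)
  have "linear_extension sc (\<lambda>(x, y, z). F x y z) d = 0" if "d \<in> slot_relations scale slots3" for d
    using that unfolding slot_relations_def slots3_def
    by (auto simp: L.diff linear_extension_single[OF assms(1)]
        module_hom.add[OF h[OF l1]] module_hom.add[OF h[OF l2]] module_hom.add[OF h[OF l3]]
        module_hom.scale[OF h[OF l1]] module_hom.scale[OF h[OF l2]] module_hom.scale[OF h[OF l3]])
  then have "linear_extension sc (\<lambda>(x, y, z). F x y z) d = 0"
    if "d \<in> formal.span (slot_relations scale slots3)" for d
    using L.eq_0_on_span that by blast
  moreover have "s - t \<in> formal.span (slot_relations scale slots3)"
  proof -
    have "s \<in> tensor3 scale s"
      by (simp add: tensor_class_def formal.span_zero)
    then have "s \<in> tensor3 scale t"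
      by (simp only: assms(5))
    then show ?thesis
      by (simp add: tensor_class_def)
  qed
  ultimately have "linear_extension sc (\<lambda>(x, y, z). F x y z) (s - t) = 0" .
  then show ?thesis
    by (simp add: L.diff)
qed

text \<open>The Sweedler laws hold only under multilinear expressions. The rules collected here decide
  linearity in one variable by the shape of the expression.\<close>

named_theorems lin

context hopf_algebra
begin

abbreviation "lin \<equiv> Vector_Spaces.linear scale scale"
abbreviation "functional \<equiv> Vector_Spaces.linear scale (*)"

text \<open>All Sweedler expressions take values in \<open>H\<close>; a scalar \<open>c\<close> is represented by \<open>c *s 1\<close>, so
  that one notion of linear map suffices. Threefold expressions \<open>F(a\<^sub>1, a\<^sub>2, a\<^sub>3)\<close> are nested to
  the right: \<open>sw a (\<lambda>x u. sw u (\<lambda>y z. F x y z))\<close>.\<close>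

abbreviation sw :: "'h \<Rightarrow> ('h \<Rightarrow> 'h \<Rightarrow> 'h) \<Rightarrow> 'h"
  where "sw \<equiv> sweedler scale \<Delta>"

lemma vector_space_field: "vector_space ((*) :: 'k \<Rightarrow> 'k \<Rightarrow> 'k)"
  by unfold_locales (simp_all add: distrib_left distrib_right)

lemma module_field: "module ((*) :: 'k \<Rightarrow> 'k \<Rightarrow> 'k)"
  by unfold_locales (simp_all add: distrib_left distrib_right)

lemma lin_iff: "lin f \<longleftrightarrow> (\<forall>x y. f (x + y) = f x + f y) \<and> (\<forall>c x. f (c *s x) = c *s f x)"
  unfolding Vector_Spaces.linear_def module_hom_def module_hom_axioms_def
  using module_axioms vector_space_axioms by blast

lemma functional_iff:
  "functional f \<longleftrightarrow> (\<forall>x y. f (x + y) = f x + f y) \<and> (\<forall>c x. f (c *s x) = c * f x)"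
  unfolding Vector_Spaces.linear_def module_hom_def module_hom_axioms_def
  using module_axioms vector_space_axioms vector_space_field module_field by blast

lemma lin_simps:
  assumes "lin f"
  shows "f (x + y) = f x + f y" "f (x - y) = f x - f y" "f (c *s x) = c *s f x" "f 0 = 0"
    "f (sum k A) = (\<Sum>i\<in>A. f (k i))"
proof -
  interpret L: Vector_Spaces.linear scale scale f by fact
  show "f (x + y) = f x + f y" "f (x - y) = f x - f y" "f (c *s x) = c *s f x" "f 0 = 0"
    "f (sum k A) = (\<Sum>i\<in>A. f (k i))"
    by (rule L.add L.diff L.scale L.zero L.sum)+
qed

lemma functional_simps:
  assumes "functional f"
  shows "f (x + y) = f x + f y" "f (x - y) = f x - f y" "f (c *s x) = c * f x" "f 0 = 0"
    "f (sum k A) = (\<Sum>i\<in>A. f (k i))"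
proof -
  interpret L: Vector_Spaces.linear scale "(*)" f by fact
  show "f (x + y) = f x + f y" "f (x - y) = f x - f y" "f (c *s x) = c * f x" "f 0 = 0"
    "f (sum k A) = (\<Sum>i\<in>A. f (k i))"
    by (rule L.add L.diff L.scale L.zero L.sum)+
qed

lemma lin_id [lin]: "lin (\<lambda>x. x)"
  by (simp add: lin_iff)

lemma lin_mult_right [lin]: "lin f \<Longrightarrow> lin (\<lambda>x. f x * b)"
  by (simp add: lin_iff distrib_right scale_mult_left)

lemma lin_mult_left [lin]: "lin f \<Longrightarrow> lin (\<lambda>x. b * f x)"
  by (simp add: lin_iff distrib_left mult_scale_right)

lemma lin_scale [lin]: "lin f \<Longrightarrow> lin (\<lambda>x. c *s f x)"
  by (simp add: lin_iff scale_right_distrib mult.commute)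

lemma lin_antipode [lin]: "lin f \<Longrightarrow> lin (\<lambda>x. S (f x))"
  using antipode_linear by (simp add: lin_iff)

lemma lin_functional: "functional \<phi> \<Longrightarrow> lin f \<Longrightarrow> lin (\<lambda>x. \<phi> (f x) *s w)"
  by (simp add: lin_iff functional_iff scale_left_distrib)

lemma lin_compose: "lin g \<Longrightarrow> lin f \<Longrightarrow> lin (\<lambda>x. g (f x))"
  by (simp add: lin_iff)

lemma functional_comp: "functional \<phi> \<Longrightarrow> lin f \<Longrightarrow> functional (\<lambda>x. \<phi> (f x))"
  by (simp add: lin_iff functional_iff)

lemmas lin_counit [lin] = lin_functional[OF counit_linear]

lemma lin_sum: "(\<And>i. i \<in> A \<Longrightarrow> lin (F i)) \<Longrightarrow> lin (\<lambda>x. \<Sum>i\<in>A. F i x)"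
  by (simp add: lin_iff sum.distrib scale_sum_right)

text \<open>The coset \<open>\<Delta> a\<close> is given by some formal sum, while Sweedler expressions are evaluated at a
  chosen element of it; two elements of a coset determine the same coset.\<close>

lemma comult_representative: "\<Delta> a = tensor2 scale (representative (\<Delta> a))"
proof -
  obtain t where t: "\<Delta> a = tensor2 scale t"
    using comult_tensor[of a] by blast
  then have "t \<in> \<Delta> a"
    by (simp add: tensor_class_def formal.span_zero)
  then have "representative (\<Delta> a) \<in> \<Delta> a"
    unfolding representative_def by (rule someI)
  then have d: "representative (\<Delta> a) - t \<in> formal.span (slot_relations scale slots2)"
    by (simp add: t tensor_class_def)
  have eq: "s - t \<in> formal.span (slot_relations scale slots2) \<longleftrightarrow>
      s - representative (\<Delta> a) \<in> formal.span (slot_relations scale slots2)" for s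
  proof
    assume "s - t \<in> formal.span (slot_relations scale slots2)"
    from formal.span_diff[OF this d] show "s - representative (\<Delta> a) \<in> formal.span (slot_relations scale slots2)"
      by simp
  next
    assume "s - representative (\<Delta> a) \<in> formal.span (slot_relations scale slots2)"
    from formal.span_add[OF this d] show "s - t \<in> formal.span (slot_relations scale slots2)"
      by simp
  qed
  have "tensor2 scale t = tensor2 scale (representative (\<Delta> a))"
    unfolding tensor_class_def using eq by blast
  with t show ?thesis
    by (rule trans)
qed

lemma sw_eqI:
  assumes "\<Delta> a = tensor2 scale t"
    and "\<And>y. lin (\<lambda>x. F x y)" "\<And>x. lin (F x)"
  shows "sw a F = linear_extension scale (\<lambda>(x, y). F x y) t"
proof -
  have "representative (\<Delta> a) \<in> tensor2 scale (representative (\<Delta> a))"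
    by (simp add: tensor_class_def formal.span_zero)
  then have "representative (\<Delta> a) \<in> tensor2 scale t"
    using comult_representative[of a] assms(1) by simp
  then show ?thesis
    unfolding sweedler_def
    by (intro linear_extension_tensor2_cong vector_space_axioms assms(2,3))
qed

lemma lin_sw [lin]:
  assumes f: "lin f" and F: "\<And>y. lin (\<lambda>x. F x y)" "\<And>x. lin (F x)"
  shows "lin (\<lambda>z. sw (f z) F)"
proof -
  interpret L: Vector_Spaces.linear formal_scale scale "linear_extension scale (\<lambda>(x, y). F x y)"
    by (rule linear_linear_extension[OF vector_space_axioms])
  have "sw (a + b) F = sw a F + sw b F" for a b
    by (subst sw_eqI[OF comult_add F]) (simp add: L.add sweedler_def)
  moreover have "sw (c *s a) F = c *s sw a F" for a c
    by (subst sw_eqI[OF comult_scale F]) (simp add: L.scale sweedler_def)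
  ultimately show ?thesis
    using f by (simp add: lin_iff)
qed

lemma lin_sw_arg [lin]:
  assumes "\<And>x y. lin (\<lambda>z. F z x y)"
  shows "lin (\<lambda>z. sw b (F z))"
  unfolding sweedler_def linear_extension_def
  by (intro lin_sum lin_scale) (auto simp: split_beta assms)

lemma lin_apply_sw: "lin \<phi> \<Longrightarrow> \<phi> (sw a F) = sw a (\<lambda>x y. \<phi> (F x y))"
  unfolding sweedler_def linear_extension_def by (simp add: lin_simps[of \<phi>] split_beta)

lemma functional_apply_sw: "functional \<phi> \<Longrightarrow> \<phi> (sw a F) *s w = sw a (\<lambda>x y. \<phi> (F x y) *s w)"
  using lin_apply_sw[OF lin_functional[OF _ lin_id]] by simp

lemma sw_mult_right: "sw a F * b = sw a (\<lambda>x y. F x y * b)"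
  by (rule lin_apply_sw[of "\<lambda>z. z * b"]) (intro lin)

lemma sw_mult_left: "b * sw a F = sw a (\<lambda>x y. b * F x y)"
  by (rule lin_apply_sw[of "\<lambda>z. b * z"]) (intro lin)

lemma sw_scale: "c *s sw a F = sw a (\<lambda>x y. c *s F x y)"
  by (rule lin_apply_sw[of "\<lambda>z. c *s z"]) (intro lin)

lemma sw_add: "sw a (\<lambda>x y. F x y + G x y) = sw a F + sw a G"
  unfolding sweedler_def linear_extension_def
  by (simp add: split_beta scale_right_distrib sum.distrib)

lemma sw_sum: "sw a (\<lambda>x y. \<Sum>i\<in>A. F i x y) = (\<Sum>i\<in>A. sw a (F i))"
  unfolding sweedler_def linear_extension_def
  by (simp add: split_beta scale_sum_right) (rule sum.swap)

lemma sw_swap: "sw a (\<lambda>x y. sw b (\<lambda>p q. F x y p q)) = sw b (\<lambda>p q. sw a (\<lambda>x y. F x y p q))"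
  unfolding sweedler_def linear_extension_def
  by (simp add: split_beta scale_sum_right mult.commute) (rule sum.swap)

lemma sw_coassoc:
  assumes F: "\<And>y z. lin (\<lambda>x. F x y z)" "\<And>x z. lin (\<lambda>y. F x y z)" "\<And>x y. lin (\<lambda>z. F x y z)"
  shows "sw a (\<lambda>u z. sw u (\<lambda>x y. F x y z)) = sw a (\<lambda>x u. sw u (\<lambda>y z. F x y z))"
proof -
  note ext = linear_extension_linear_extension[OF vector_space_axioms]
    linear_extension_single[OF vector_space_axioms]
  have "linear_extension scale (\<lambda>(x, y, z). F x y z) (sweedler formal_scale \<Delta> a (\<lambda>x y.
          sweedler formal_scale \<Delta> x (\<lambda>p q. Poly_Mapping.single (p, q, y) 1))) =
       linear_extension scale (\<lambda>(x, y, z). F x y z) (sweedler formal_scale \<Delta> a (\<lambda>x y.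
          sweedler formal_scale \<Delta> y (\<lambda>p q. Poly_Mapping.single (x, p, q) 1)))"
    by (rule linear_extension_tensor3_cong[OF vector_space_axioms F coassoc])
  then show ?thesis
    unfolding sweedler_def by (simp add: ext case_prod_unfold)
qed

lemma sw_mult:
  assumes F: "\<And>y. lin (\<lambda>x. F x y)" "\<And>x. lin (F x)"
  shows "sw (a * b) F = sw a (\<lambda>x y. sw b (\<lambda>p q. F (x * p) (y * q)))"
  by (subst sw_eqI[OF comult_mult F])
    (simp add: tensor_mult_def sweedler_def case_prod_unfold
      linear_extension_linear_extension[OF vector_space_axioms]
      linear_extension_single[OF vector_space_axioms])

lemma sw_one:
  assumes F: "\<And>y. lin (\<lambda>x. F x y)" "\<And>x. lin (F x)"
  shows "sw 1 F = F 1 1"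
  by (subst sw_eqI[OF comult_one F]) (simp add: linear_extension_single[OF vector_space_axioms])

lemma sw_counit_left: "lin f \<Longrightarrow> sw a (\<lambda>x y. \<epsilon> x *s f y) = f a"
  using lin_apply_sw[of f a "\<lambda>x y. \<epsilon> x *s y"] by (simp add: counit_left lin_simps[of f])

lemma sw_counit_right: "lin f \<Longrightarrow> sw a (\<lambda>x y. \<epsilon> y *s f x) = f a"
  using lin_apply_sw[of f a "\<lambda>x y. \<epsilon> y *s x"] by (simp add: counit_right lin_simps[of f])

lemma sw_antipode_left: "lin f \<Longrightarrow> sw a (\<lambda>x y. f (S x * y)) = \<epsilon> a *s f 1"
  using lin_apply_sw[of f a "\<lambda>x y. S x * y"] by (simp add: antipode_left lin_simps[of f])

lemma sw_antipode_right: "lin f \<Longrightarrow> sw a (\<lambda>x y. f (x * S y)) = \<epsilon> a *s f 1"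
  using lin_apply_sw[of f a "\<lambda>x y. x * S y"] by (simp add: antipode_right lin_simps[of f])

text \<open>The four laws that follow cancel two neighbouring factors among \<open>a\<^sub>1, a\<^sub>2, a\<^sub>3\<close>, one of them
  under \<open>S\<close>: the first two in one pair of laws, the last two in the other.\<close>

lemma sw_antipode_left_first:
  assumes F: "\<And>y. lin (\<lambda>x. F x y)" "\<And>x. lin (F x)"
  shows "sw a (\<lambda>x u. sw u (\<lambda>y z. F (S x * y) z)) = F 1 a"
proof -
  have "sw a (\<lambda>x u. sw u (\<lambda>y z. F (S x * y) z)) = sw a (\<lambda>u z. sw u (\<lambda>x y. F (S x * y) z))"
    by (rule sw_coassoc[symmetric])
      (intro lin F lin_compose[OF F(1)])+
  also have "\<dots> = sw a (\<lambda>u z. \<epsilon> u *s F 1 z)"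
    by (simp add: sw_antipode_left[OF F(1)])
  finally show ?thesis
    by (simp add: sw_counit_left[OF F(2)])
qed

lemma sw_antipode_right_first:
  assumes F: "\<And>y. lin (\<lambda>x. F x y)" "\<And>x. lin (F x)"
  shows "sw a (\<lambda>x u. sw u (\<lambda>y z. F (x * S y) z)) = F 1 a"
proof -
  have "sw a (\<lambda>x u. sw u (\<lambda>y z. F (x * S y) z)) = sw a (\<lambda>u z. sw u (\<lambda>x y. F (x * S y) z))"
    by (rule sw_coassoc[symmetric])
      (intro lin F lin_compose[OF F(1)])+
  also have "\<dots> = sw a (\<lambda>u z. \<epsilon> u *s F 1 z)"
    by (simp add: sw_antipode_right[OF F(1)])
  finally show ?thesis
    by (simp add: sw_counit_left[OF F(2)])
qed

lemma sw_antipode_left_last: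
  assumes F: "\<And>y. lin (\<lambda>x. F x y)" "\<And>x. lin (F x)"
  shows "sw a (\<lambda>x u. sw u (\<lambda>y z. F x (S y * z))) = F a 1"
  by (simp add: sw_antipode_left[OF F(2)] sw_counit_right[OF F(1)])

lemma sw_antipode_right_last:
  assumes F: "\<And>y. lin (\<lambda>x. F x y)" "\<And>x. lin (F x)"
  shows "sw a (\<lambda>x u. sw u (\<lambda>y z. F x (y * S z))) = F a 1"
  by (simp add: sw_antipode_right[OF F(2)] sw_counit_right[OF F(1)])

end

section \<open>The antipode is an anti-homomorphism of algebras and of coalgebras\<close>

context hopf_algebra
begin

lemma antipode_one: "S 1 = 1"
proof -
  have "sw 1 (\<lambda>x y. S x * y) = S 1 * 1"
    by (rule sw_one) (intro lin)+
  then show ?thesis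
    by (simp add: antipode_left counit_one)
qed

text \<open>Both sides equal \<open>S(b\<^sub>1) S(a\<^sub>1) a\<^sub>2 b\<^sub>2 S(a\<^sub>3 b\<^sub>3)\<close>: cancel \<open>a\<^sub>2 b\<^sub>2\<close> with the factor on its right
  or with the factors on its left.\<close>

lemma antipode_mult: "S (a * b) = S b * S a"
proof -
  have "S b * S a = sw a (\<lambda>a1 a'. \<epsilon> a' *s (S b * S a1))"
    by (rule sw_counit_right[symmetric]) (intro lin)
  also have "\<dots> = sw a (\<lambda>a1 a'. sw b (\<lambda>b1 b'. \<epsilon> b' *s \<epsilon> a' *s (S b1 * S a1)))"
    by (subst sw_counit_right) (intro lin refl)+
  also have "\<dots> = sw a (\<lambda>a1 a'. sw b (\<lambda>b1 b'. S b1 * S a1 * sw (a' * b') (\<lambda>u v. u * S v)))"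
    by (simp add: antipode_right counit_mult mult_scale_right mult.commute)
  also have "\<dots> = sw a (\<lambda>a1 a'. sw b (\<lambda>b1 b'.
      sw a' (\<lambda>a2 a3. sw b' (\<lambda>b2 b3. S b1 * S a1 * (a2 * b2 * S (a3 * b3))))))"
    by (subst sw_mult) (intro lin | simp add: sw_mult_left)+
  also have "\<dots> = sw a (\<lambda>a1 a'. sw a' (\<lambda>a2 a3.
      sw b (\<lambda>b1 b'. sw b' (\<lambda>b2 b3. S b1 * ((S a1 * a2) * (b2 * S (a3 * b3)))))))"
    by (subst sw_swap) (simp only: mult.assoc)
  also have "\<dots> = sw b (\<lambda>b1 b'. sw b' (\<lambda>b2 b3. S b1 * (1 * (b2 * S (a * b3)))))"
    by (rule sw_antipode_left_first[of
          "\<lambda>p q. sw b (\<lambda>b1 b'. sw b' (\<lambda>b2 b3. S b1 * (p * (b2 * S (q * b3)))))"]) (intro lin)+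
  also have "\<dots> = sw b (\<lambda>b1 b'. sw b' (\<lambda>b2 b3. (S b1 * b2) * S (a * b3)))"
    by (simp add: mult.assoc)
  also have "\<dots> = 1 * S (a * b)"
    by (rule sw_antipode_left_first) (intro lin)+
  finally show ?thesis
    by simp
qed

lemma counit_antipode: "\<epsilon> (S a) = \<epsilon> a"
proof -
  have "\<epsilon> (S a) *s 1 = \<epsilon> (S (sw a (\<lambda>x y. \<epsilon> y *s x))) *s 1"
    by (simp add: counit_right)
  also have "\<dots> = sw a (\<lambda>x y. \<epsilon> (S (\<epsilon> y *s x)) *s 1)"
    by (rule lin_apply_sw) (intro lin)
  also have "\<dots> = sw a (\<lambda>x y. \<epsilon> (S x * y) *s 1)"
    by (simp add: counit_mult lin_simps[OF antipode_linear] functional_simps[OF counit_linear] mult.commute)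
  also have "\<dots> = \<epsilon> a *s \<epsilon> 1 *s 1"
    by (rule sw_antipode_left) (intro lin)
  finally show ?thesis
    by (simp add: counit_one)
qed

lemma sw_coassoc_four:
  assumes T: "\<And>y z w. lin (\<lambda>x. T x y z w)" "\<And>x z w. lin (\<lambda>y. T x y z w)"
    "\<And>x y w. lin (\<lambda>z. T x y z w)" "\<And>x y z. lin (\<lambda>w. T x y z w)"
  shows "sw a (\<lambda>p w. sw p (\<lambda>x q. sw q (\<lambda>y z. T x y z w))) =
    sw a (\<lambda>x b. sw b (\<lambda>y c. sw c (\<lambda>z w. T x y z w)))"
proof -
  have "sw a (\<lambda>p w. sw p (\<lambda>x q. sw q (\<lambda>y z. T x y z w))) =
      sw a (\<lambda>x b. sw b (\<lambda>q w. sw q (\<lambda>y z. T x y z w)))"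
    by (rule sw_coassoc) (intro lin T)+
  also have "\<dots> = sw a (\<lambda>x b. sw b (\<lambda>y c. sw c (\<lambda>z w. T x y z w)))"
    by (subst sw_coassoc) (intro T refl)+
  finally show ?thesis .
qed

text \<open>That is, \<open>\<Delta>(S a) = S(a\<^sub>2) \<otimes> S(a\<^sub>1)\<close>. Both sides equal \<open>\<Delta>(S(a\<^sub>1)) (a\<^sub>2 S(a\<^sub>5) \<otimes> a\<^sub>3 S(a\<^sub>4))\<close>:
  either \<open>\<Delta>(S(a\<^sub>1)) \<Delta>(a\<^sub>2)\<close> collapses because \<open>\<Delta>\<close> is multiplicative, or first \<open>a\<^sub>3 S(a\<^sub>4)\<close> and then
  \<open>a\<^sub>2 S(a\<^sub>3)\<close> does.\<close>

lemma sw_antipode: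
  assumes F: "\<And>y. lin (\<lambda>x. F x y)" "\<And>x. lin (F x)"
  shows "sw (S a) F = sw a (\<lambda>x y. F (S y) (S x))"
proof -
  note FI = lin F lin_compose[OF F(1)] lin_compose[OF F(2)]
  define T where "T a1 a2 a3 c = sw (S a1) (\<lambda>u v. sw c (\<lambda>a4 a5. F (u * a2 * S a5) (v * a3 * S a4)))" for a1 a2 a3 c
  have T: "lin (\<lambda>x. T x y z w)" "lin (\<lambda>y. T x y z w)" "lin (\<lambda>z. T x y z w)" "lin (\<lambda>w. T x y z w)"
    for x y z w
    unfolding T_def by (intro FI)+
  have "sw a (\<lambda>x y. F (S y) (S x)) = sw a (\<lambda>p d. \<epsilon> p *s sw d (\<lambda>a4 a5. F (S a5) (S a4)))"
    by (rule sw_counit_left[symmetric]) (intro FI)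
  also have "\<dots> = sw a (\<lambda>p d. sw p (\<lambda>a1 q. sw (S a1 * q) (\<lambda>u v. sw d (\<lambda>a4 a5. F (u * S a5) (v * S a4)))))"
    (is "_ = sw a (\<lambda>p d. sw p (\<lambda>a1 q. ?f d (S a1 * q)))")
  proof -
    have f: "lin (?f d)" for d
      by (intro FI)
    have "?f d 1 = sw d (\<lambda>a4 a5. F (S a5) (S a4))" for d
      by (subst sw_one) (intro FI | simp)+
    then show ?thesis
      by (subst sw_antipode_left[OF f]) simp
  qed
  also have "\<dots> = sw a (\<lambda>p d. sw p (\<lambda>a1 q. sw q (\<lambda>a2 a3. T a1 a2 a3 d)))"
  proof -
    have "?f d (S a1 * q) = sw q (\<lambda>a2 a3. T a1 a2 a3 d)" for d a1 q
      unfolding T_def by (subst sw_swap, subst sw_mult) (intro FI refl)+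
    then show ?thesis
      by simp
  qed
  also have "\<dots> = sw a (\<lambda>a1 b. sw b (\<lambda>a2 c. sw c (\<lambda>a3 d. T a1 a2 a3 d)))"
    by (rule sw_coassoc_four) (intro T)+
  also have "\<dots> = sw a (\<lambda>a1 b. sw b (\<lambda>a2 c. sw (S a1) (\<lambda>u v. F (u * (a2 * S c)) v)))"
  proof -
    have "sw c (\<lambda>a3 d. T a1 a2 a3 d) = sw (S a1) (\<lambda>u v. F (u * (a2 * S c)) v)" for a1 a2 c
    proof -
      have "sw c (\<lambda>a3 d. T a1 a2 a3 d) =
          sw (S a1) (\<lambda>u v. sw c (\<lambda>a3 d. sw d (\<lambda>a4 a5. F (u * (a2 * S a5)) (v * (a3 * S a4)))))"
        unfolding T_def by (subst sw_swap) (simp only: mult.assoc)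
      also have "\<dots> = sw (S a1) (\<lambda>u v. F (u * (a2 * S c)) (v * 1))"
        by (subst sw_antipode_right_first[of "\<lambda>p q. F (u * (a2 * S q)) (v * p)" for u v])
          (intro FI refl)+
      finally show ?thesis
        by simp
    qed
    then show ?thesis
      by simp
  qed
  also have "\<dots> = sw (S a) (\<lambda>u v. F (u * 1) v)"
    by (rule sw_antipode_right_last[of "\<lambda>x y. sw (S x) (\<lambda>u v. F (u * y) v)"]) (intro FI)+
  finally show ?thesis
    by simp
qed

end

section \<open>Integrals of the dual from traces\<close>

context hopf_algebra
begin

text \<open>The right action of the dual algebra on \<open>H\<close>, often written \<open>a \<leftharpoonup> f\<close>.\<close>

definition hit :: "('h \<Rightarrow> 'k) \<Rightarrow> 'h \<Rightarrow> 'h"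
  where "hit f a = sw a (\<lambda>x y. f x *s y)"

lemma lin_hit: "functional f \<Longrightarrow> lin g \<Longrightarrow> lin (\<lambda>x. hit f (g x))"
  unfolding hit_def by (intro lin lin_functional)

lemma hit_counit: "hit \<epsilon> a = a"
  by (simp add: hit_def counit_left)

text \<open>Coassociativity in operator form: \<open>\<Delta>(a \<leftharpoonup> f) = (a\<^sub>1 \<leftharpoonup> f) \<otimes> a\<^sub>2\<close>.\<close>

lemma sw_hit:
  assumes f: "functional f" and F: "\<And>y. lin (\<lambda>x. F x y)" "\<And>x. lin (F x)"
  shows "sw (hit f a) F = sw a (\<lambda>x y. F (hit f x) y)"
proof -
  have "sw (hit f a) F = sw a (\<lambda>x u. sw (f x *s u) F)"
    unfolding hit_def by (rule lin_apply_sw) (intro lin F)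
  also have "\<dots> = sw a (\<lambda>x u. sw u (\<lambda>y z. f x *s F y z))"
    by (subst lin_simps(3)[of "\<lambda>u. sw u F"]) (intro lin F | simp add: sw_scale)+
  also have "\<dots> = sw a (\<lambda>u z. sw u (\<lambda>x y. f x *s F y z))"
    by (rule sw_coassoc[symmetric]) (intro lin F lin_functional[OF f])+
  also have "\<dots> = sw a (\<lambda>u z. F (hit f u) z)"
    unfolding hit_def
    by (subst lin_apply_sw[of "\<lambda>x. F x z" for z]) (simp_all add: F lin_simps(3)[OF F(1)])
  finally show ?thesis .
qed

text \<open>This is \<open>S(h) a\<^sub>1 \<otimes> a\<^sub>2 = (S(h\<^sub>2) a)\<^sub>1 \<otimes> h\<^sub>1 (S(h\<^sub>2) a)\<^sub>2\<close>. It says that the dual of \<open>H\<close>, with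
  the action \<open>(h, f) \<mapsto> f (S h * _)\<close> and the coaction coming from right multiplication by
  functionals, is a Hopf module; all properties of integrals rest on it.\<close>

lemma sw_antipode_mult:
  assumes G: "\<And>y. lin (\<lambda>x. G x y)" "\<And>x. lin (G x)"
  shows "sw h (\<lambda>h1 h2. sw (S h2 * a) (\<lambda>x y. G x (h1 * y))) = sw a (\<lambda>x y. G (S h * x) y)"
proof -
  note GI = lin G lin_compose[OF G(1)] lin_compose[OF G(2)]
  have "sw (S h2 * a) (\<lambda>x y. G x (h1 * y)) =
      sw h2 (\<lambda>k1 k2. sw a (\<lambda>x y. G (S k2 * x) (h1 * S k1 * y)))" for h1 h2
    by (subst sw_mult, (intro GI)+, subst sw_antipode, (intro GI)+) (simp only: mult.assoc)
  then have "sw h (\<lambda>h1 h2. sw (S h2 * a) (\<lambda>x y. G x (h1 * y))) =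
      sw h (\<lambda>h1 h2. sw h2 (\<lambda>k1 k2. sw a (\<lambda>x y. G (S k2 * x) (h1 * S k1 * y))))"
    by simp
  also have "\<dots> = sw a (\<lambda>x y. G (S h * x) (1 * y))"
    by (rule sw_antipode_right_first[of "\<lambda>p q. sw a (\<lambda>x y. G (S q * x) (p * y))"]) (intro GI)+
  finally show ?thesis
    by simp
qed

end

locale finite_dimensional_hopf_algebra =
  hopf_algebra scale \<Delta> \<epsilon> S + finite_dimensional_vector_space scale Basis
  for scale :: "'k::field \<Rightarrow> 'h::ring_1 \<Rightarrow> 'h" (infixr \<open>*s\<close> 75)
    and \<Delta> \<epsilon> S Basis
begin

definition coord :: "'h \<Rightarrow> 'h \<Rightarrow> 'k"
  where "coord b x = representation Basis x b"

lemma functional_coord: "functional (coord b)"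
  by (simp add: functional_iff coord_def representation_add representation_scale
      independent_Basis span_Basis)

text \<open>Used from right to left to introduce a sum over the basis, and from left to right to
  contract one; this takes the place of a dual basis.\<close>

lemma sum_coord_lin:
  assumes "lin f"
  shows "(\<Sum>b\<in>Basis. coord b x *s f b) = f x"
proof -
  have "(\<Sum>b\<in>Basis. coord b x *s b) = x"
    unfolding coord_def
    by (rule sum_representation_eq) (simp_all add: independent_Basis span_Basis finite_Basis)
  from arg_cong[OF this, of f] show ?thesis
    by (simp add: lin_simps[OF assms])
qed

lemma sum_coord_functional: "functional f \<Longrightarrow> (\<Sum>b\<in>Basis. coord b x * f b) = f x"
  using sum_coord_lin[of "\<lambda>x. f x *s 1" x] lin_functional[of f "\<lambda>x. x" 1]
  by (simp add: lin_id scale_sum_left[symmetric])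

lemma coord_eqI:
  assumes "\<And>b. b \<in> Basis \<Longrightarrow> coord b x = coord b y"
  shows "x = y"
proof -
  have "(\<Sum>b\<in>Basis. coord b x *s b) = (\<Sum>b\<in>Basis. coord b y *s b)"
    using assms by simp
  then show ?thesis
    by (simp add: sum_coord_lin[OF lin_id])
qed

lemma eq_zeroI: "(\<And>f. functional f \<Longrightarrow> f x = 0) \<Longrightarrow> x = 0"
  using functional_coord by (intro coord_eqI) (simp add: functional_simps(4))

definition trace :: "('h \<Rightarrow> 'h) \<Rightarrow> 'k"
  where "trace L = (\<Sum>b\<in>Basis. coord b (L b))"

text \<open>The projection of a functional onto the coinvariants of the Hopf module formed by the
  dual, \<open>f \<mapsto> S(f\<^sub>-\<^sub>1) f\<^sub>0\<close>, written out in a basis.\<close>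

definition trace_integral :: "('h \<Rightarrow> 'k) \<Rightarrow> 'h \<Rightarrow> 'k"
  where "trace_integral f a = trace (\<lambda>b. hit f (S (S b) * a))"

lemma functional_sum: "(\<And>i. i \<in> A \<Longrightarrow> functional (F i)) \<Longrightarrow> functional (\<lambda>x. \<Sum>i\<in>A. F i x)"
  by (simp add: functional_iff sum.distrib sum_distrib_left)

text \<open>Coinvariants of this Hopf module are the right integrals. In the computation,
  \<open>sw_antipode_mult\<close> moves \<open>S\<^sup>2(b)\<close> out of the first tensor factor and leaves a factor \<open>S(b\<^sub>2)\<close> on
  the second one; expanding \<open>L(b\<^sub>1)\<close> in the basis moves that factor around the trace, where it
  meets its partner and cancels.\<close>

lemma trace_integral:
  assumes f: "functional f"
  shows "dual_right_integral (trace_integral f)"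
  unfolding dual_right_integral_def
proof (intro conjI allI)
  show "functional (trace_integral f)"
    unfolding trace_integral_def trace_def
    by (intro functional_sum functional_comp[OF functional_coord] lin_hit[OF f] lin)
  fix a
  define L where "L x = hit f (S (S x) * a)" for x
  have L: "lin g \<Longrightarrow> lin (\<lambda>x. L (g x))" for g
    unfolding L_def by (intro lin lin_hit[OF f])
  note I = lin lin_functional[OF functional_coord] lin_hit[OF f] L
  have "sw a (\<lambda>x y. trace_integral f x *s y) =
      (\<Sum>b\<in>Basis. sw a (\<lambda>x y. coord b (hit f (S (S b) * x)) *s y))"
    by (simp add: trace_integral_def trace_def scale_sum_left sw_sum)
  also have "\<dots> = (\<Sum>b\<in>Basis. \<Sum>c\<in>Basis.
      sw c (\<lambda>x y. coord b x *s sw b (\<lambda>b1 b2. coord c (L b1) *s (S b2 * y))))"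
  proof (rule sum.cong[OF refl])
    fix b
    have "sw a (\<lambda>x y. coord b (hit f (S (S b) * x)) *s y) =
        sw (S b) (\<lambda>h1 h2. sw (S h2 * a) (\<lambda>x y. coord b (hit f x) *s (h1 * y)))"
      by (rule sw_antipode_mult[symmetric]) (intro I)+
    also have "\<dots> = sw b (\<lambda>b1 b2. sw (S (S b1) * a) (\<lambda>x y. coord b (hit f x) *s (S b2 * y)))"
      by (rule sw_antipode) (intro I)+
    also have "\<dots> = sw b (\<lambda>b1 b2. sw (L b1) (\<lambda>x y. coord b x *s (S b2 * y)))"
      unfolding L_def by (subst sw_hit[OF f]) (intro I refl)+
    also have "\<dots> = sw b (\<lambda>b1 b2. \<Sum>c\<in>Basis. coord c (L b1) *s
        sw c (\<lambda>x y. coord b x *s (S b2 * y)))"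
      by (subst sum_coord_lin) (intro I refl)+
    also have "\<dots> = (\<Sum>c\<in>Basis. sw b (\<lambda>b1 b2. 
        sw c (\<lambda>x y. coord b x *s (coord c (L b1) *s (S b2 * y)))))"
      by (simp add: sw_sum sw_scale mult.commute)
    also have "\<dots> = (\<Sum>c\<in>Basis. sw c (\<lambda>x y. coord b x *s sw b (\<lambda>b1 b2. coord c (L b1) *s (S b2 * y))))"
      by (subst sw_swap) (simp only: sw_scale)
    finally show "sw a (\<lambda>x y. coord b (hit f (S (S b) * x)) *s y) =
        (\<Sum>c\<in>Basis. sw c (\<lambda>x y. coord b x *s sw b (\<lambda>b1 b2. coord c (L b1) *s (S b2 * y))))" .
  qed
  also have "\<dots> = (\<Sum>c\<in>Basis. sw c (\<lambda>x y. \<Sum>b\<in>Basis.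
      coord b x *s sw b (\<lambda>b1 b2. coord c (L b1) *s (S b2 * y))))"
    by (subst sum.swap) (simp only: sw_sum)
  also have "\<dots> = (\<Sum>c\<in>Basis. sw c (\<lambda>x y. sw x (\<lambda>b1 b2. coord c (L b1) *s (S b2 * y))))"
    by (subst sum_coord_lin) (intro I refl)+
  also have "\<dots> = (\<Sum>c\<in>Basis. sw c (\<lambda>b1 z. sw z (\<lambda>b2 y. coord c (L b1) *s (S b2 * y))))"
    by (subst sw_coassoc) (intro I refl)+
  also have "\<dots> = (\<Sum>c\<in>Basis. coord c (L c) *s 1)"
    by (subst sw_antipode_left_last[of "\<lambda>x y. coord c (L x) *s y" for c]) (intro I refl)+
  finally show "sw a (\<lambda>x y. trace_integral f x *s y) = trace_integral f a *s 1"
    by (simp add: trace_integral_def trace_def L_def scale_sum_left)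
qed

text \<open>In a Hopf module every element is recovered from the projections, \<open>f = f\<^sub>-\<^sub>1 P(f\<^sub>0)\<close>. This is
  the case \<open>f = \<epsilon>\<close>, evaluated at \<open>1\<close>; so the projection is not zero.\<close>

lemma sum_trace_integral: "(\<Sum>b\<in>Basis. trace_integral (coord b) (S b)) = 1"
proof -
  note I = lin lin_functional[OF functional_coord]
  have "(\<Sum>b\<in>Basis. trace_integral (coord b) (S b)) *s 1 =
      (\<Sum>b\<in>Basis. \<Sum>c\<in>Basis. coord c (sw (S (b * S c)) (\<lambda>x y. coord b x *s y)) *s 1)"
    by (simp add: trace_integral_def trace_def scale_sum_left antipode_mult hit_def)
  also have "\<dots> = (\<Sum>b\<in>Basis. \<Sum>c\<in>Basis. sw (S (b * S c)) (\<lambda>x y. coord c (coord b x *s y) *s 1))"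
    by (simp only: functional_apply_sw[OF functional_coord])
  also have "\<dots> = (\<Sum>b\<in>Basis. \<Sum>c\<in>Basis. sw (S (b * S c)) (\<lambda>x y. coord b x *s coord c y *s 1))"
    by (simp add: functional_simps(3)[OF functional_coord])
  also have "\<dots> = (\<Sum>b\<in>Basis. \<Sum>c\<in>Basis. \<Sum>d\<in>Basis. coord d (S (b * S c)) *s
      sw d (\<lambda>x y. coord b x *s coord c y *s 1))"
    by (subst sum_coord_lin) (intro I refl)+
  also have "\<dots> = (\<Sum>d\<in>Basis. sw d (\<lambda>x y. \<Sum>b\<in>Basis. \<Sum>c\<in>Basis. coord b x *s coord c y *s
      coord d (S (b * S c)) *s 1))" (is "?lhs = ?rhs")
  proof -
    have "?lhs = (\<Sum>b\<in>Basis. \<Sum>d\<in>Basis. \<Sum>c\<in>Basis. sw d (\<lambda>x y. coord d (S (b * S c)) *s coord b x *s coord c y *s 1))"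
      by (subst sum.swap) (simp only: sw_scale)
    also have "\<dots> = (\<Sum>d\<in>Basis. \<Sum>b\<in>Basis. \<Sum>c\<in>Basis. sw d (\<lambda>x y. coord d (S (b * S c)) *s coord b x *s coord c y *s 1))"
      by (rule sum.swap)
    also have "\<dots> = ?rhs"
      by (simp add: sw_sum mult.commute mult.left_commute)
    finally show ?thesis .
  qed
  also have "\<dots> = (\<Sum>d\<in>Basis. sw d (\<lambda>x y. coord d (S (x * S y)) *s 1))"
  proof -
    have "(\<Sum>b\<in>Basis. \<Sum>c\<in>Basis. coord b x *s coord c y *s coord d (S (b * S c)) *s 1) =
        coord d (S (x * S y)) *s 1" for d x y
    proof -
      have "(\<Sum>c\<in>Basis. coord c y *s coord d (S (b * S c)) *s 1) = coord d (S (b * S y)) *s 1" for b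
        by (rule sum_coord_lin) (intro I)
      then have "(\<Sum>b\<in>Basis. \<Sum>c\<in>Basis. coord b x *s coord c y *s coord d (S (b * S c)) *s 1) =
          (\<Sum>b\<in>Basis. coord b x *s coord d (S (b * S y)) *s 1)"
        by (simp only: scale_sum_right[symmetric])
      also have "\<dots> = coord d (S (x * S y)) *s 1"
        by (rule sum_coord_lin) (intro I)
      finally show ?thesis .
    qed
    then show ?thesis
      by simp
  qed
  also have "\<dots> = (\<Sum>d\<in>Basis. \<epsilon> d *s coord d 1 *s 1)"
    by (subst sw_antipode_right[of "\<lambda>z. coord d (S z) *s 1" for d]) (intro I | simp add: antipode_one)+
  also have "\<dots> = (\<Sum>d\<in>Basis. coord d 1 *s \<epsilon> d *s 1)"
    by (simp add: mult.commute)
  also have "\<dots> = \<epsilon> 1 *s 1"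
    by (rule sum_coord_lin) (intro I)
  finally show ?thesis
    by (simp only: counit_one scale_cancel_right) simp
qed

lemma dual_right_integral_exists: "\<exists>l. dual_right_integral l \<and> (\<exists>a. l a \<noteq> 0)"
proof -
  have "\<exists>b\<in>Basis. trace_integral (coord b) (S b) \<noteq> 0"
  proof (rule ccontr)
    assume "\<not> ?thesis"
    then have "(\<Sum>b\<in>Basis. trace_integral (coord b) (S b)) = 0"
      by (intro sum.neutral) blast
    then show False
      by (simp add: sum_trace_integral)
  qed
  then show ?thesis
    using trace_integral[OF functional_coord] by blast
qed

end

section \<open>The integral as a Frobenius form\<close>

context hopf_algebra
begin

lemma sw_zero: "sw a (\<lambda>x y. 0) = 0"
  by (simp add: sweedler_def linear_extension_def case_prod_unfold)

lemma scalar_eqI: "c *s 1 = d *s 1 \<Longrightarrow> c = d"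
  by (simp only: scale_cancel_right) simp

lemma functional_hit:
  assumes f: "functional f" and \<phi>: "functional \<phi>"
  shows "f (hit \<phi> a) = \<phi> (sw a (\<lambda>x y. f y *s x))"
proof (rule scalar_eqI)
  show "f (hit \<phi> a) *s 1 = \<phi> (sw a (\<lambda>x y. f y *s x)) *s 1"
    unfolding hit_def
    by (simp add: functional_apply_sw[OF f] functional_apply_sw[OF \<phi>] functional_simps(3)[OF f]
        functional_simps(3)[OF \<phi>] mult.commute)
qed

lemma counit_hit: "functional \<phi> \<Longrightarrow> \<epsilon> (hit \<phi> a) = \<phi> a"
  by (simp add: functional_hit counit_linear counit_right)

end

context finite_dimensional_hopf_algebra
begin

text \<open>Expanding \<open>a\<^sub>1\<close> in the basis: \<open>\<Delta>(a) = \<Sum>\<^sub>b b \<otimes> (a \<leftharpoonup> b\<^sup>*)\<close>.\<close>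

lemma sw_expand_left:
  assumes F: "\<And>y. lin (\<lambda>x. F x y)" "\<And>x. lin (F x)"
  shows "sw a F = (\<Sum>b\<in>Basis. F b (hit (coord b) a))"
proof -
  have "sw a F = sw a (\<lambda>x y. \<Sum>b\<in>Basis. coord b x *s F b y)"
    by (subst sum_coord_lin[OF F(1)]) simp
  also have "\<dots> = (\<Sum>b\<in>Basis. F b (hit (coord b) a))"
    by (simp add: sw_sum hit_def lin_apply_sw[OF F(2)] lin_simps(3)[OF F(2)])
  finally show ?thesis .
qed

lemma coord_basis_sum: "b \<in> Basis \<Longrightarrow> coord b (\<Sum>c\<in>Basis. r c *s c) = r b"
proof -
  assume b: "b \<in> Basis"
  have "coord b (\<Sum>c\<in>Basis. r c *s c) = (\<Sum>c\<in>Basis. r c * coord b c)"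
    by (simp add: functional_simps[OF functional_coord])
  also have "\<dots> = (\<Sum>c\<in>Basis. if c = b then r c else 0)"
    by (intro sum.cong refl) (simp add: coord_def representation_basis[OF independent_Basis])
  also have "\<dots> = r b"
    using b by (simp add: finite_Basis)
  finally show ?thesis .
qed

text \<open>A nondegenerate form identifies \<open>H\<close> with its dual. The dual is replaced by \<open>H\<close> itself
  through the values of a functional on the basis, so that injectivity of an endomorphism of \<open>H\<close>
  gives surjectivity.\<close>

lemma functional_representable:
  assumes \<beta>1: "\<And>a. functional (\<lambda>h. \<beta> h a)" and \<beta>2: "\<And>h. functional (\<beta> h)"
    and nondeg: "\<And>h. (\<And>a. \<beta> h a = 0) \<Longrightarrow> h = 0"
    and f: "functional f"
  shows "\<exists>h. \<forall>a. f a = \<beta> h a"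
proof -
  define T where "T h = (\<Sum>c\<in>Basis. \<beta> h c *s c)" for h
  have T: "coord b (T h) = \<beta> h b" if "b \<in> Basis" for b h
    unfolding T_def using coord_basis_sum[OF that] .
  have lT: "lin T"
    unfolding T_def by (intro lin_sum lin_functional[OF \<beta>1] lin_id)
  have det: "f = g" if "functional f" "functional g" "\<And>b. b \<in> Basis \<Longrightarrow> f b = g b" for f g
  proof
    fix a
    show "f a = g a"
      using sum_coord_functional[OF that(1), of a] sum_coord_functional[OF that(2), of a] that(3)
      by simp
  qed
  have z: "functional (\<lambda>_. 0)"
    by (simp add: functional_iff)
  have "h = 0" if "T h = 0" for h
  proof -
    have "\<beta> h b = 0" if "b \<in> Basis" for b
      using T[OF that, of h] \<open>T h = 0\<close> by (simp add: functional_simps(4)[OF functional_coord])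
    then have "\<beta> h = (\<lambda>_. 0)"
      by (intro det \<beta>2 z) auto
    then show ?thesis
      by (intro nondeg) simp
  qed
  then have "inj T"
    using lin_simps(2)[OF lT] unfolding inj_def by (metis right_minus_eq)
  then have "surj T"
    by (rule linear_inj_imp_surj[OF lT])
  then obtain h where h: "(\<Sum>b\<in>Basis. f b *s b) = T h"
    by (metis surjD)
  have "f b = \<beta> h b" if "b \<in> Basis" for b
    using coord_basis_sum[OF that, of f] T[OF that, of h] by (simp add: h)
  then have "f = \<beta> h"
    by (intro det f \<beta>2)
  then show ?thesis
    by auto
qed

context
  fixes l
  assumes integral: "dual_right_integral l" and nonzero: "\<exists>a. l a \<noteq> 0"
begin

lemma functional_l: "functional l"
  using integral by (simp add: dual_right_integral_def)

lemma hit_l: "sw a (\<lambda>x y. l x *s y) = l a *s 1"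
  using integral by (simp add: dual_right_integral_def)

lemmas lin_l = lin_functional[OF functional_l]

text \<open>Combining \<open>sw_antipode_mult\<close> with \<open>l(x\<^sub>1) x\<^sub>2 = l(x) 1\<close> gives the rule
  \<open>h\<^sub>1 l(S(h\<^sub>2) a) = l(S(h) a\<^sub>1) a\<^sub>2\<close>. Its counterpart for right multiplication comes next; the two
  are compared in \<open>integral_nakayama\<close>.\<close>

lemma sw_integral_mult_left: "sw h (\<lambda>h1 h2. l (S h2 * a) *s h1) = sw a (\<lambda>x y. l (S h * x) *s y)"
proof -
  have "sw a (\<lambda>x y. l (S h * x) *s y) = sw h (\<lambda>h1 h2. sw (S h2 * a) (\<lambda>x y. l x *s (h1 * y)))"
    by (rule sw_antipode_mult[symmetric]) (intro lin lin_l)+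
  also have "\<dots> = sw h (\<lambda>h1 h2. h1 * sw (S h2 * a) (\<lambda>x y. l x *s y))"
    by (simp only: sw_mult_left mult_scale_right)
  finally show ?thesis
    by (simp add: hit_l mult_scale_right)
qed

lemma sw_integral_mult_right: "sw h (\<lambda>h1 h2. l (a * h1) *s S h2) = sw a (\<lambda>x y. l (x * h) *s y)"
proof -
  have "sw h (\<lambda>h1 h2. l (a * h1) *s S h2) = sw h (\<lambda>h1 h2. sw (a * h1) (\<lambda>x y. l x *s y) * S h2)"
    by (simp add: hit_l scale_mult_left)
  also have "\<dots> = sw h (\<lambda>h1 h2. sw a (\<lambda>x y. sw h1 (\<lambda>p q. l (x * p) *s (y * q))) * S h2)"
    by (subst sw_mult) (intro lin lin_l refl)+
  also have "\<dots> = sw a (\<lambda>x y. sw h (\<lambda>h1 h2. sw h1 (\<lambda>p q. l (x * p) *s (y * (q * S h2)))))"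
    by (subst sw_swap) (simp only: sw_mult_right scale_mult_left mult.assoc)
  also have "\<dots> = sw a (\<lambda>x y. sw h (\<lambda>p u. sw u (\<lambda>q h2. l (x * p) *s (y * (q * S h2)))))"
    by (subst sw_coassoc) (intro lin lin_l refl)+
  also have "\<dots> = sw a (\<lambda>x y. l (x * h) *s (y * 1))"
    by (subst sw_antipode_right_last[of "\<lambda>p z. l (x * p) *s (y * z)" for x y]) (intro lin lin_l refl)+
  finally show ?thesis
    by simp
qed

text \<open>By \<open>sw_integral_mult_left\<close> the left radical of the form \<open>(h, a) \<mapsto> l(S(h) a)\<close> is stable
  under \<open>h \<mapsto> h \<leftharpoonup> \<phi>\<close>. So for \<open>k\<close> in the radical all \<open>k\<^sub>2\<close> may be taken in it, and
  \<open>\<epsilon>(k) l(a) = l(S(k\<^sub>2) S\<^sup>2(k\<^sub>1) a) = 0\<close>. Hence \<open>\<epsilon>\<close> vanishes on the radical, and by stability so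
  does every functional \<open>\<phi>(h) = \<epsilon>(h \<leftharpoonup> \<phi>)\<close>.\<close>

lemma integral_nondegenerate_antipode:
  assumes "\<And>a. l (S h * a) = 0"
  shows "h = 0"
proof -
  have stable: "l (S (hit \<phi> k) * a) = 0" if k: "\<And>a. l (S k * a) = 0" and \<phi>: "functional \<phi>" for \<phi> k a
  proof -
    have "l (S (hit \<phi> k) * a) = \<phi> (sw k (\<lambda>x y. l (S y * a) *s x))"
      by (rule functional_hit) (intro functional_comp[OF functional_l] lin \<phi>)+
    also have "\<dots> = 0"
      by (simp add: sw_integral_mult_left k sw_zero functional_simps(4)[OF \<phi>])
    finally show ?thesis .
  qed
  have counit: "\<epsilon> k = 0" if k: "\<And>a. l (S k * a) = 0" for k
  proof -
    have "\<epsilon> k * l a = 0" for a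
    proof (rule scalar_eqI)
      have "(\<epsilon> k * l a) *s 1 = \<epsilon> k *s l (S 1 * a) *s 1"
        by (simp add: antipode_one)
      also have "\<dots> = sw k (\<lambda>x y. l (S (S x * y) * a) *s 1)"
        by (rule sw_antipode_left[symmetric]) (intro lin lin_l)
      also have "\<dots> = sw k (\<lambda>x y. l (S y * (S (S x) * a)) *s 1)"
        by (simp only: antipode_mult mult.assoc)
      also have "\<dots> = (\<Sum>b\<in>Basis. l (S (hit (coord b) k) * (S (S b) * a)) *s 1)"
        by (rule sw_expand_left) (intro lin lin_l)+
      also have "\<dots> = 0 *s 1"
        by (simp add: stable k functional_coord)
      finally show "(\<epsilon> k * l a) *s 1 = 0 *s 1" .
    qed
    with nonzero show ?thesis
      by auto
  qed
  show "h = 0"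
  proof (rule eq_zeroI)
    fix \<phi> assume \<phi>: "functional \<phi>"
    have "\<epsilon> (hit \<phi> h) = 0"
      by (intro counit stable assms \<phi>)
    then show "\<phi> h = 0"
      by (simp add: counit_hit \<phi>)
  qed
qed

text \<open>If \<open>S h = 0\<close> then \<open>h\<close> lies in the radical.\<close>

lemma bij_antipode: "bij S"
proof -
  have "h = 0" if "S h = 0" for h
    using that by (intro integral_nondegenerate_antipode) (simp add: functional_simps(4)[OF functional_l])
  then have "inj S"
    using lin_simps(2)[OF antipode_linear] unfolding inj_def by (metis right_minus_eq)
  then show ?thesis
    using linear_inj_imp_surj[OF antipode_linear] by (simp add: bij_def)
qed

lemma integral_nondegenerate_left:
  assumes "\<And>a. l (h * a) = 0"
  shows "h = 0"
proof -
  obtain k where "h = S k"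
    using bij_antipode by (metis bij_def surjD)
  with assms integral_nondegenerate_antipode[of k] show ?thesis
    by (simp add: lin_simps(4)[OF antipode_linear])
qed

lemma functional_as_integral_antipode: "functional f \<Longrightarrow> \<exists>h. \<forall>a. f a = l (S h * a)"
  by (rule functional_representable)
    (intro functional_comp[OF functional_l] lin integral_nondegenerate_antipode | assumption)+

lemma integral_nondegenerate_right:
  assumes "\<And>a. l (a * h) = 0"
  shows "h = 0"
proof (rule eq_zeroI)
  fix f assume "functional f"
  with assms show "f h = 0"
    by (metis functional_as_integral_antipode)
qed

lemma functional_as_integral_right: "functional f \<Longrightarrow> \<exists>h. \<forall>a. f a = l (a * h)"
  by (rule functional_representable)
    (intro functional_comp[OF functional_l] lin integral_nondegenerate_right | assumption)+

text \<open>Write \<open>m = l (S h * _)\<close>. The integral property of \<open>m\<close> and nondegeneracy give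
  \<open>h\<^sub>1 \<otimes> h\<^sub>2 = 1 \<otimes> h\<close>, so \<open>h\<close> is a scalar.\<close>

lemma dual_right_integral_unique:
  assumes m: "dual_right_integral m"
  shows "\<exists>c. \<forall>a. m a = c * l a"
proof -
  have "functional m" and m_int: "sw a (\<lambda>x y. m x *s y) = m a *s 1" for a
    using m by (auto simp: dual_right_integral_def)
  then obtain h where h: "\<And>a. m a = l (S h * a)"
    using functional_as_integral_antipode by metis
  have "h - \<epsilon> h *s 1 = 0"
  proof (rule eq_zeroI)
    fix \<phi> assume \<phi>: "functional \<phi>"
    have "hit \<phi> h - \<phi> 1 *s h = 0"
    proof (rule integral_nondegenerate_antipode)
      fix a
      have "l (S (hit \<phi> h) * a) = \<phi> (sw h (\<lambda>x y. l (S y * a) *s x))"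
        by (rule functional_hit) (intro functional_comp[OF functional_l] lin \<phi>)+
      also have "\<dots> = \<phi> (sw a (\<lambda>x y. m x *s y))"
        by (simp add: sw_integral_mult_left h)
      also have "\<dots> = l (S h * a) * \<phi> 1"
        by (simp only: m_int functional_simps(3)[OF \<phi>]) (simp only: h)
      finally show "l (S (hit \<phi> h - \<phi> 1 *s h) * a) = 0"
        by (simp add: lin_simps(2,3)[OF antipode_linear] left_diff_distrib scale_mult_left
            functional_simps(2,3)[OF functional_l])
    qed
    then have "\<epsilon> (hit \<phi> h) = \<phi> 1 * \<epsilon> h"
      by (simp add: functional_simps(3)[OF counit_linear])
    then show "\<phi> (h - \<epsilon> h *s 1) = 0"
      by (simp add: counit_hit \<phi> functional_simps(2,3)[OF \<phi>])
  qed
  then have "S h = \<epsilon> h *s 1"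
    by (metis antipode_one eq_iff_diff_eq_0 lin_simps(3)[OF antipode_linear])
  then have "m a = \<epsilon> h * l a" for a
    by (simp add: h scale_mult_left functional_simps(3)[OF functional_l])
  then show ?thesis
    by blast
qed

section \<open>The distinguished group-like element\<close>

abbreviation g where "g \<equiv> distinguished_grouplike"

lemma normalized_element: "\<exists>a. l a = 1"
proof -
  obtain a where "l a \<noteq> 0"
    using nonzero by blast
  then have "l (inverse (l a) *s a) = 1"
    by (simp add: functional_simps(3)[OF functional_l])
  then show ?thesis ..
qed

text \<open>For every functional \<open>f\<close> the map \<open>a \<mapsto> f(a\<^sub>1) l(a\<^sub>2)\<close> is a right integral, hence a multiple
  of \<open>l\<close>; the multiple depends linearly on \<open>f\<close> and so is \<open>f(g)\<close> for one element \<open>g\<close>. Rescaling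
  \<open>l\<close> does not change \<open>g\<close>.\<close>

lemma sw_distinguished: "sw a (\<lambda>x y. l y *s x) = l a *s g"
proof -
  obtain a0 where a0: "l a0 = 1"
    using normalized_element by blast
  define g0 where "g0 = sw a0 (\<lambda>x y. l y *s x)"
  have g0: "sw a (\<lambda>x y. l y *s x) = l a *s g0" for a
  proof -
    have "sw a (\<lambda>x y. l y *s x) - l a *s g0 = 0"
    proof (rule eq_zeroI)
      fix f assume f: "functional f"
      have "dual_right_integral (\<lambda>a. l (hit f a))"
        unfolding dual_right_integral_def
      proof (intro conjI allI)
        show "functional (\<lambda>a. l (hit f a))"
          by (intro functional_comp[OF functional_l] lin_hit[OF f] lin)
        show "sw a (\<lambda>x y. l (hit f x) *s y) = l (hit f a) *s 1" for a
          using sw_hit[OF f, of "\<lambda>x y. l x *s y" a] by (simp add: lin lin_l hit_l)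
      qed
      then obtain c where c: "\<And>a. l (hit f a) = c * l a"
        using dual_right_integral_unique by blast
      have "f (sw a (\<lambda>x y. l y *s x)) = c * l a" for a
        using c[of a] by (simp add: functional_hit functional_l f)
      from this[of a] this[of a0] show "f (sw a (\<lambda>x y. l y *s x) - l a *s g0) = 0"
        by (simp add: a0 g0_def functional_simps(2,3)[OF f])
    qed
    then show ?thesis
      by simp
  qed
  have "g = g0"
    unfolding distinguished_grouplike_def
  proof (rule the_equality)
    show "\<exists>l. dual_right_integral l \<and> (\<exists>a. l a \<noteq> 0) \<and> (\<forall>a. sw a (\<lambda>x y. l y *s x) = l a *s g0)"
      using integral nonzero g0 by blast
  next
    fix g' assume "\<exists>l. dual_right_integral l \<and> (\<exists>a. l a \<noteq> 0) \<and> (\<forall>a. sw a (\<lambda>x y. l y *s x) = l a *s g')"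
    then obtain m a where m: "dual_right_integral m" "m a \<noteq> 0" "sw a (\<lambda>x y. m y *s x) = m a *s g'"
      by blast
    obtain c where c: "\<And>a. m a = c * l a"
      using dual_right_integral_unique[OF m(1)] by blast
    have "sw a (\<lambda>x y. m y *s x) = c *s sw a (\<lambda>x y. l y *s x)"
      by (simp add: c sw_scale)
    also have "\<dots> = m a *s g0"
      by (simp add: g0 c)
    finally show "g' = g0"
      using m by simp
  qed
  with g0 show ?thesis
    by simp
qed

text \<open>Apply \<open>\<Delta>\<close> to \<open>g = a\<^sub>1 l(a\<^sub>2)\<close> with \<open>l(a) = 1\<close>, and use the defining property of \<open>g\<close> twice.\<close>

lemma sw_grouplike:
  assumes F: "\<And>y. lin (\<lambda>x. F x y)" "\<And>x. lin (F x)"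
  shows "sw g F = F g g"
proof -
  note I = lin lin_l F lin_compose[OF F(1)] lin_compose[OF F(2)]
  obtain a0 where a0: "l a0 = 1"
    using normalized_element by blast
  then have g: "g = sw a0 (\<lambda>x y. l y *s x)"
    by (simp add: sw_distinguished)
  have "sw g F = sw a0 (\<lambda>x y. sw (l y *s x) F)"
    unfolding g by (rule lin_apply_sw) (intro I)
  also have "\<dots> = sw a0 (\<lambda>x y. sw x (\<lambda>p q. l y *s F p q))"
    by (subst lin_simps(3)[of "\<lambda>u. sw u F"]) (intro I | simp add: sw_scale)+
  also have "\<dots> = sw a0 (\<lambda>p z. sw z (\<lambda>q y. l y *s F p q))"
    by (rule sw_coassoc) (intro I)+
  also have "\<dots> = sw a0 (\<lambda>p z. F p (sw z (\<lambda>q y. l y *s q)))"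
    by (simp add: lin_apply_sw[OF F(2)] lin_simps(3)[OF F(2)])
  also have "\<dots> = sw a0 (\<lambda>p z. l z *s F p g)"
    by (simp add: sw_distinguished lin_simps(3)[OF F(2)])
  also have "\<dots> = F (sw a0 (\<lambda>p z. l z *s p)) g"
    by (simp add: lin_apply_sw[OF F(1)] lin_simps(3)[OF F(1)])
  finally show ?thesis
    using g by simp
qed

lemma counit_grouplike: "\<epsilon> g = 1"
proof -
  obtain a0 where a0: "l a0 = 1"
    using normalized_element by blast
  have "\<epsilon> (sw a0 (\<lambda>x y. l y *s x)) = l (hit \<epsilon> a0)"
    by (simp add: functional_hit functional_l counit_linear)
  with a0 show ?thesis
    by (simp add: sw_distinguished hit_counit)
qed

lemma grouplike_antipode: "g * S g = 1" "S g * g = 1"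
proof -
  have "sw g (\<lambda>x y. x * S y) = g * S g" "sw g (\<lambda>x y. S x * y) = S g * g"
    by (rule sw_grouplike; intro lin)+
  then show "g * S g = 1" "S g * g = 1"
    by (simp_all add: antipode_left antipode_right counit_grouplike)
qed

lemma unit_inverse_grouplike: "unit_inverse g = S g"
  unfolding unit_inverse_def
proof (rule the_equality)
  show "g * S g = 1 \<and> S g * g = 1"
    by (simp add: grouplike_antipode)
  fix v assume "g * v = 1 \<and> v * g = 1"
  then show "v = S g"
    by (metis grouplike_antipode(2) mult.assoc mult.left_neutral mult.right_neutral)
qed

lemma antipode_antipode_grouplike: "S (S g) = g"
proof -
  have "S g * S (S g) = 1"
    by (metis antipode_mult antipode_one grouplike_antipode(2))
  then show ?thesis
    by (metis grouplike_antipode(1) mult.assoc mult.left_neutral mult.right_neutral)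
qed

section \<open>The Nakayama automorphism and the fourth power of the antipode\<close>

text \<open>The element representing \<open>\<epsilon>\<close> with respect to the form \<open>l(a b)\<close> is a left integral;
  nondegeneracy turns \<open>\<epsilon>(a k) = \<epsilon>(a) \<epsilon>(k)\<close> into the integral property.\<close>

lemma left_integral_exists: "\<exists>\<Lambda>. left_integral \<Lambda> \<and> (\<forall>a. l (a * \<Lambda>) = \<epsilon> a)"
proof -
  obtain \<Lambda> where \<Lambda>: "\<And>a. \<epsilon> a = l (a * \<Lambda>)"
    using functional_as_integral_right[OF counit_linear] by blast
  have "k * \<Lambda> = \<epsilon> k *s \<Lambda>" for k
  proof -
    have "l (a * (k * \<Lambda> - \<epsilon> k *s \<Lambda>)) = 0" for a
      using \<Lambda>[of "a * k"] \<Lambda>[of a]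
      by (simp add: counit_mult right_diff_distrib mult_scale_right mult.assoc mult.commute[of _ "\<epsilon> k"]
          functional_simps(2,3)[OF functional_l])
    then have "k * \<Lambda> - \<epsilon> k *s \<Lambda> = 0"
      by (rule integral_nondegenerate_right)
    then show ?thesis
      by simp
  qed
  with \<Lambda>[symmetric] show ?thesis
    unfolding left_integral_def by blast
qed

text \<open>The integral \<open>\<Lambda>\<close> dual to \<open>l\<close> satisfies \<open>l(S(k) \<Lambda>\<^sub>1) \<Lambda>\<^sub>2 = k\<close>, and, being a right integral
  too, \<open>l(\<Lambda>\<^sub>1 h) \<Lambda>\<^sub>2 = S(h)\<close>. Taking \<open>k = S(h)\<close> shows that \<open>l(S\<^sup>2(h) _)\<close> and \<open>l(_ h)\<close> agree on the
  elements \<open>\<Lambda>\<^sub>1\<close>; by the first formula a functional \<open>l(S(k) _)\<close> vanishing there is zero.\<close>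

lemma integral_nakayama:
  assumes unimodular
  shows "l (x * h) = l (S (S h) * x)"
proof -
  obtain \<Lambda> where "left_integral \<Lambda>" and l\<Lambda>: "\<And>a. l (a * \<Lambda>) = \<epsilon> a"
    using left_integral_exists by blast
  then have \<Lambda>: "\<Lambda> * a = \<epsilon> a *s \<Lambda>" for a
    using assms by (simp add: unimodular_def right_integral_def)
  have l1: "l \<Lambda> = 1"
    using l\<Lambda>[of 1] by (simp add: counit_one)
  have left: "sw \<Lambda> (\<lambda>x y. l (S k * x) *s y) = k" for k
    by (simp add: sw_integral_mult_left[symmetric] l\<Lambda> counit_antipode counit_right)
  have right: "sw \<Lambda> (\<lambda>x y. l (x * h) *s y) = S h"
    by (simp add: sw_integral_mult_right[symmetric] \<Lambda> functional_simps(3)[OF functional_l] l1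
        sw_counit_left[OF antipode_linear])
  \<comment> \<open>\<open>f\<close> vanishes on all \<open>\<Lambda>\<^sub>1\<close>, so its representing element \<open>k\<close> is zero\<close>
  define f where "f x = l (S (S h) * x) - l (x * h)" for x
  have "functional f"
    unfolding f_def functional_iff
    by (simp add: functional_simps[OF functional_l] distrib_left distrib_right mult_scale_right
        scale_mult_left right_diff_distrib)
  then obtain k where k: "\<And>x. f x = l (S k * x)"
    using functional_as_integral_antipode by blast
  have "k = sw \<Lambda> (\<lambda>x y. f x *s y)"
    by (simp add: k left)
  also have "sw \<Lambda> (\<lambda>x y. f x *s y) + sw \<Lambda> (\<lambda>x y. l (x * h) *s y) = sw \<Lambda> (\<lambda>x y. l (S (S h) * x) *s y)"
    by (simp add: sw_add[symmetric] f_def scale_left_diff_distrib)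
  then have "sw \<Lambda> (\<lambda>x y. f x *s y) = 0"
    by (simp add: left right)
  finally have "f x = 0"
    by (simp add: k lin_simps(4)[OF antipode_linear] functional_simps(4)[OF functional_l])
  then show ?thesis
    by (simp add: f_def)
qed

text \<open>The functional \<open>a \<mapsto> l(S(a) g)\<close> is a right integral: the factor \<open>g\<close> converts the right
  integral \<open>l\<close> into a left one, and composing with \<open>S\<close> exchanges the sides again.\<close>

lemma integral_antipode: "\<exists>c. \<forall>a. l (S a * g) = c * l a"
proof (rule dual_right_integral_unique, unfold dual_right_integral_def, intro conjI allI)
  show "functional (\<lambda>a. l (S a * g))"
    by (intro functional_comp[OF functional_l] lin)
  fix a
  \<comment> \<open>compare after applying the injective map \<open>S\<close>\<close>
  have "S (sw a (\<lambda>x y. l (S x * g) *s y)) = sw a (\<lambda>x y. l (S x * g) *s S y)"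
    by (simp add: lin_apply_sw[OF antipode_linear] lin_simps(3)[OF antipode_linear])
  also have "\<dots> = sw (S a) (\<lambda>u v. l (v * g) *s u)"
    by (rule sw_antipode[symmetric]) (intro lin lin_l)+
  also have "\<dots> = sw (S a) (\<lambda>u v. sw g (\<lambda>p q. l (v * q) *s (u * p * S g)))"
    by (subst sw_grouplike) (intro lin lin_l | simp add: grouplike_antipode mult.assoc)+
  also have "\<dots> = sw (S a * g) (\<lambda>u v. l v *s (u * S g))"
    by (rule sw_mult[symmetric]) (intro lin lin_l)+
  also have "\<dots> = sw (S a * g) (\<lambda>u v. l v *s u) * S g"
    by (simp add: sw_mult_right scale_mult_left)
  also have "\<dots> = S (l (S a * g) *s 1)"
    by (simp add: sw_distinguished scale_mult_left grouplike_antipode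
        lin_simps(3)[OF antipode_linear] antipode_one)
  finally show "sw a (\<lambda>x y. l (S x * g) *s y) = l (S a * g) *s 1"
    using bij_antipode by (simp add: bij_def inj_eq)
qed

text \<open>This is \<open>S\<^sup>4(z) = g z g\<inverse>\<close>. Put \<open>z = S(y)\<close>; then \<open>l(g S(y) S(x)) = l(S\<^sup>5(y) g S(x))\<close> for all
  \<open>x\<close>, by passing through \<open>l(x y) = l(S\<^sup>2(y) x)\<close>.\<close>

lemma grouplike_mult_eq_antipode_power4:
  assumes unimodular
  shows "g * z = S (S (S (S z))) * g"
proof -
  obtain c where c: "\<And>a. l (S a * g) = c * l a"
    using integral_antipode by blast
  obtain y where y: "z = S y"
    using bij_antipode by (metis bij_def surjD)
  note nak = integral_nakayama[OF assms]
  have "l ((g * S y - S (S (S (S (S y)))) * g) * w) = 0" for w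
  proof -
    obtain x where x: "w = S x"
      using bij_antipode by (metis bij_def surjD)
    have "l (g * S y * S x) = l (S y * S x * g)"
      using nak[of "S y * S x" g] by (simp add: antipode_antipode_grouplike mult.assoc)
    also have "\<dots> = c * l (x * y)"
      using c[of "x * y"] by (simp add: antipode_mult)
    also have "\<dots> = c * l (S (S y) * x)"
      by (simp add: nak[of x y])
    also have "\<dots> = l (S x * (S (S (S y)) * g))"
      using c[of "S (S y) * x"] by (simp add: antipode_mult mult.assoc)
    also have "\<dots> = l (S (S (S (S (S y)))) * g * S x)"
      by (simp add: nak[of "S x"] antipode_mult antipode_antipode_grouplike)
    finally show ?thesis
      by (simp add: x left_diff_distrib functional_simps(2)[OF functional_l])
  qed
  then have "g * S y - S (S (S (S (S y)))) * g = 0"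
    by (rule integral_nondegenerate_left)
  then show ?thesis
    by (simp add: y)
qed

end

end

section \<open>Adjoint action and commutators\<close>

context hopf_algebra
begin

text \<open>Cancellation of \<open>S(c\<^sub>2) c\<^sub>3\<close> in \<open>c\<^sub>1, \<dots>, c\<^sub>4\<close>, in the form in which it arises when a product
  of two Sweedler expressions in \<open>c\<^sub>1\<close> and \<open>c\<^sub>2\<close> is formed.\<close>

lemma sw_antipode_left_middle:
  assumes P: "\<And>y z. lin (\<lambda>x. P x y z)" "\<And>x z. lin (\<lambda>y. P x y z)" "\<And>x y. lin (\<lambda>z. P x y z)"
  shows "sw c (\<lambda>c1 c2. sw c1 (\<lambda>r t. sw c2 (\<lambda>u v. P r (S t * u) v))) = sw c (\<lambda>r v. P r 1 v)"
proof -
  have "sw c (\<lambda>c1 c2. sw c1 (\<lambda>r t. sw c2 (\<lambda>u v. P r (S t * u) v))) =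
      sw c (\<lambda>r d. sw d (\<lambda>t c2. sw c2 (\<lambda>u v. P r (S t * u) v)))"
    by (rule sw_coassoc) (intro lin P lin_compose[OF P(2)])+
  also have "\<dots> = sw c (\<lambda>r v. P r 1 v)"
    by (subst sw_antipode_left_first) (intro P refl)+
  finally show ?thesis .
qed

lemma lin_adjoint_left [lin]: "lin f \<Longrightarrow> lin (\<lambda>x. adjoint_action (f x) b)"
  unfolding adjoint_action_def by (intro lin)

lemma lin_adjoint_right [lin]: "lin f \<Longrightarrow> lin (\<lambda>x. adjoint_action h (f x))"
  unfolding adjoint_action_def by (intro lin)

lemma adjoint_action_one: "adjoint_action h 1 = \<epsilon> h *s 1"
  by (simp add: adjoint_action_def antipode_right)

lemma adjoint_action_mult_right:
  "adjoint_action h (x * y) = sw h (\<lambda>h1 h2. adjoint_action h1 x * adjoint_action h2 y)"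
proof -
  have "sw h (\<lambda>h1 h2. adjoint_action h1 x * adjoint_action h2 y) =
      sw h (\<lambda>h1 h2. sw h1 (\<lambda>p q. sw h2 (\<lambda>r t. p * x * (S q * r) * y * S t)))"
    by (simp only: adjoint_action_def sw_mult_right) (simp only: sw_mult_left mult.assoc)
  also have "\<dots> = sw h (\<lambda>p t. p * x * 1 * y * S t)"
    by (rule sw_antipode_left_middle[of "\<lambda>p z t. p * x * z * y * S t"]) (intro lin)+
  finally show ?thesis
    by (simp add: adjoint_action_def mult.assoc)
qed

lemma adjoint_action_mult_left:
  "adjoint_action (h * k) x = adjoint_action h (adjoint_action k x)"
proof -
  have "adjoint_action (h * k) x = sw h (\<lambda>p q. sw k (\<lambda>r t. (p * r) * x * S (q * t)))"
    unfolding adjoint_action_def by (rule sw_mult) (intro lin)+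
  then show ?thesis
    by (simp only: adjoint_action_def sw_mult_left sw_mult_right antipode_mult mult.assoc)
qed

text \<open>The commutator without squares of the antipode and without group-like factor; for group
  elements it is \<open>a b a\<inverse> b\<inverse>\<close>.\<close>

definition plain_commutator :: "'h \<Rightarrow> 'h \<Rightarrow> 'h"
  where "plain_commutator a b = sw a (\<lambda>a1 a2. sw b (\<lambda>b1 b2. a1 * b1 * S a2 * S b2))"

lemma plain_commutator_adjoint_left:
  "plain_commutator a b = sw b (\<lambda>b1 b2. adjoint_action a b1 * S b2)"
  unfolding plain_commutator_def adjoint_action_def
  by (subst sw_swap) (simp only: sw_mult_right)

lemma plain_commutator_adjoint_right:
  "plain_commutator a b = sw a (\<lambda>a1 a2. a1 * adjoint_action b (S a2))"
  unfolding plain_commutator_def adjoint_action_def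
  by (simp only: sw_mult_left mult.assoc)

text \<open>Since \<open>[c, b] = (c \<rhd> b\<^sub>1) S(b\<^sub>2)\<close> and \<open>[b, k] = b\<^sub>1 (k \<rhd> S(b\<^sub>2))\<close>, the product
  \<open>[c, b\<^sub>1] [b\<^sub>2, k]\<close> telescopes to \<open>(c \<rhd> b\<^sub>1) (k \<rhd> S(b\<^sub>2))\<close>. For \<open>c = h\<^sub>1 a\<close> and \<open>k = h\<^sub>2\<close> this is
  \<open>h \<rhd> ((a \<rhd> b\<^sub>1) S(b\<^sub>2))\<close>.\<close>

lemma adjoint_plain_commutator:
  "adjoint_action h (plain_commutator a b) =
    sw h (\<lambda>h1 h2. sw b (\<lambda>b1 b2. plain_commutator (h1 * a) b1 * plain_commutator b2 h2))"
proof -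
  have "sw b (\<lambda>b1 b2. plain_commutator c b1 * plain_commutator b2 h2) =
      sw b (\<lambda>b1 b2. adjoint_action c b1 * adjoint_action h2 (S b2))" for c h2
  proof -
    have "sw b (\<lambda>b1 b2. plain_commutator c b1 * plain_commutator b2 h2) =
        sw b (\<lambda>b1 b2. sw b1 (\<lambda>r t. sw b2 (\<lambda>u v.
          adjoint_action c r * (S t * u) * adjoint_action h2 (S v))))"
      by (simp only: plain_commutator_adjoint_left[of c] plain_commutator_adjoint_right[of _ h2]
          sw_mult_right) (simp only: sw_mult_left mult.assoc)
    also have "\<dots> = sw b (\<lambda>r v. adjoint_action c r * 1 * adjoint_action h2 (S v))"
      by (rule sw_antipode_left_middle[of "\<lambda>r z v. adjoint_action c r * z * adjoint_action h2 (S v)"])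
        (intro lin)+
    finally show ?thesis
      by simp
  qed
  then have "sw h (\<lambda>h1 h2. sw b (\<lambda>b1 b2. plain_commutator (h1 * a) b1 * plain_commutator b2 h2)) =
      sw h (\<lambda>h1 h2. sw b (\<lambda>b1 b2. adjoint_action h1 (adjoint_action a b1) * adjoint_action h2 (S b2)))"
    by (simp add: adjoint_action_mult_left)
  also have "\<dots> = sw b (\<lambda>b1 b2. adjoint_action h (adjoint_action a b1 * S b2))"
    by (subst sw_swap) (simp only: adjoint_action_mult_right)
  also have "\<dots> = adjoint_action h (plain_commutator a b)"
    unfolding plain_commutator_adjoint_left
    by (rule lin_apply_sw[symmetric]) (intro lin)
  finally show ?thesis ..
qed

lemma plain_commutator_one: "plain_commutator a 1 = \<epsilon> a *s 1"
proof -
  have "plain_commutator a 1 = adjoint_action a 1 * S 1"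
    unfolding plain_commutator_adjoint_left by (rule sw_one) (intro lin)+
  then show ?thesis
    by (simp add: antipode_one adjoint_action_one)
qed

lemma subspace_sw: "subspace N \<Longrightarrow> (\<And>x y. F x y \<in> N) \<Longrightarrow> sw a F \<in> N"
  unfolding sweedler_def linear_extension_def
  by (auto intro!: subspace_sum subspace_scale)

lemma sw_antipode_antipode:
  assumes F: "\<And>y. lin (\<lambda>x. F x y)" "\<And>x. lin (F x)"
  shows "sw (S (S a)) F = sw a (\<lambda>x y. F (S (S x)) (S (S y)))"
proof -
  have "sw (S (S a)) F = sw (S a) (\<lambda>x y. F (S y) (S x))"
    by (rule sw_antipode) (intro F)+
  also have "\<dots> = sw a (\<lambda>x y. F (S (S x)) (S (S y)))"
    by (rule sw_antipode) (intro lin lin_compose[OF F(1)] lin_compose[OF F(2)])+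
  finally show ?thesis .
qed

lemma subalgebra_commutator_subalgebra: "subalgebra commutator_subalgebra"
  unfolding commutator_subalgebra_def
  by (rule hull_in) (auto simp: subalgebra_def intro!: subspace_Inter)

end

context finite_dimensional_hopf_algebra
begin

text \<open>Left multiplication by \<open>u\<close> is an injective endomorphism of the finite-dimensional space
  \<open>N\<close>, so it reaches \<open>1\<close>.\<close>

lemma subalgebra_inverse:
  assumes N: "subalgebra N" and u: "u \<in> N" and uv: "u * v = 1" "v * u = 1"
  shows "v \<in> N"
proof -
  interpret P: finite_dimensional_vector_space_pair_1 scale Basis scale
    by unfold_locales
  have sub: "subspace N"
    using N by (simp add: subalgebra_def)
  let ?f = "\<lambda>x. u * x"
  have lf: "lin ?f"
    by (intro lin)
  have "inj_on ?f (span N)"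
    by (rule inj_on_inverseI[of _ "\<lambda>x. v * x"]) (simp add: mult.assoc[symmetric] uv)
  then have "dim (?f ` N) = dim N"
    by (rule P.dim_image_eq[OF lf])
  moreover have "subspace (?f ` N)"
    by (rule P.linear_subspace_image[OF lf sub])
  moreover have "?f ` N \<subseteq> N"
    using N u by (auto simp: subalgebra_def)
  ultimately have "?f ` N = N"
    using sub by (intro subspace_dim_equal) auto
  then obtain n where "n \<in> N" "u * n = 1"
    using N unfolding subalgebra_def by (metis imageE)
  moreover from this have "n = v"
    using uv(2) by (metis mult.assoc mult.left_neutral mult.right_neutral)
  ultimately show ?thesis
    by simp
qed

text \<open>The formula for \<open>S\<^sup>4\<close> gives \<open>S\<^sup>-\<^sup>1(b\<^sub>2) g\<inverse> = g\<inverse> S\<^sup>3(b\<^sub>2)\<close>. Now \<open>S\<^sup>2(b\<^sub>1)\<close> and \<open>S\<^sup>3(b\<^sub>2)\<close> are the two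
  factors that \<open>S\<^sup>2(b)\<close> contributes to a plain commutator, and the \<open>g\<inverse>\<close> between \<open>S(a\<^sub>2)\<close> and
  \<open>S\<^sup>3(b\<^sub>2)\<close> comes from \<open>S(g a\<^sub>2)\<close>; the leading \<open>g\<close> of \<open>g a\<^sub>1\<close> is cancelled by the factor in front.\<close>

lemma commutator_eq_plain_commutator:
  assumes unimodular
  shows "commutator a b = S distinguished_grouplike *
    plain_commutator (distinguished_grouplike * a) (S (S b))"
proof -
  obtain l where l: "dual_right_integral l" "\<exists>a. l a \<noteq> 0"
    using dual_right_integral_exists by blast
  let ?g = distinguished_grouplike
  note gS = grouplike_antipode[OF l]
  have inv: "inv S z * S ?g = S ?g * S (S (S z))" for z
  proof -
    have "?g * inv S z = S (S (S z)) * ?g"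
      using grouplike_mult_eq_antipode_power4[OF l assms, of "inv S z"] bij_antipode[OF l]
      by (simp add: bij_def surj_f_inv_f)
    then have "S ?g * (?g * inv S z) * S ?g = S ?g * (S (S (S z)) * ?g) * S ?g"
      by simp
    then have "(S ?g * ?g) * inv S z * S ?g = S ?g * S (S (S z)) * (?g * S ?g)"
      by (simp only: mult.assoc)
    then show ?thesis
      by (simp add: gS)
  qed
  have "plain_commutator (?g * a) (S (S b)) =
      sw a (\<lambda>a1 a2. sw (S (S b)) (\<lambda>b1 b2. (?g * a1) * b1 * S (?g * a2) * S b2))"
    unfolding plain_commutator_def
    by (subst sw_mult, (intro lin)+, subst sw_grouplike[OF l]) (intro lin refl)+
  also have "\<dots> = sw a (\<lambda>a1 a2. sw b (\<lambda>b1 b2. (?g * a1) * S (S b1) * S (?g * a2) * S (S (S b2))))"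
    by (subst sw_antipode_antipode) (intro lin refl)+
  also have "\<dots> = sw a (\<lambda>a1 a2. sw b (\<lambda>b1 b2.
      ?g * (a1 * S (S b1) * S a2 * (S ?g * S (S (S b2))))))"
    by (simp only: antipode_mult mult.assoc)
  also have "\<dots> = ?g * commutator a b"
    by (simp only: commutator_def unit_inverse_grouplike[OF l] inv[symmetric] sw_mult_left mult.assoc)
  finally have "S ?g * plain_commutator (?g * a) (S (S b)) = (S ?g * ?g) * commutator a b"
    by (simp only: mult.assoc)
  then show ?thesis
    by (simp add: gS)
qed

text \<open>The commutator subalgebra contains \<open>g\<inverse>\<close>, \<open>g\<close> and hence all plain commutators; the
  subalgebra \<open>M\<close> of elements whose adjoint orbit stays inside contains the generators.\<close>

lemma normal_commutator_subalgebra: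
  assumes unimodular
  shows "normal commutator_subalgebra"
proof -
  obtain l where l: "dual_right_integral l" "\<exists>a. l a \<noteq> 0"
    using dual_right_integral_exists by blast
  let ?g = distinguished_grouplike
  let ?N = commutator_subalgebra
  note gS = grouplike_antipode[OF l] and comm = commutator_eq_plain_commutator[OF assms]
  have N: "subalgebra ?N"
    by (rule subalgebra_commutator_subalgebra)
  then have sub: "subspace ?N" and one: "1 \<in> ?N" and mult: "\<And>x y. x \<in> ?N \<Longrightarrow> y \<in> ?N \<Longrightarrow> x * y \<in> ?N"
    by (auto simp: subalgebra_def)
  have comm_N: "commutator a b \<in> ?N" for a b
    unfolding commutator_subalgebra_def by (rule hull_inc) blast
  have "commutator 1 1 = S ?g"
    by (simp add: comm antipode_one plain_commutator_one counit_grouplike[OF l])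
  with comm_N[of 1 1] have Sg: "S ?g \<in> ?N"
    by simp
  then have g: "?g \<in> ?N"
    by (rule subalgebra_inverse[OF N]) (rule gS)+
  have plain: "plain_commutator a b \<in> ?N" for a b
  proof -
    have "surj S"
      using bij_antipode[OF l] by (simp add: bij_def)
    then have "?g * commutator (S ?g * a) (inv S (inv S b)) =
        (?g * S ?g) * plain_commutator ((?g * S ?g) * a) b"
      by (simp only: comm surj_f_inv_f mult.assoc)
    then have "plain_commutator a b = ?g * commutator (S ?g * a) (inv S (inv S b))"
      by (simp add: gS)
    then show ?thesis
      by (simp add: mult g comm_N)
  qed
  define M where "M = {x. \<forall>h. adjoint_action h x \<in> ?N}"
  have "lin (adjoint_action h)" for h
    by (intro lin)
  note ad = lin_simps[OF this]
  have M_mult: "x * y \<in> M" if "x \<in> M" "y \<in> M" for x y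
    using that unfolding M_def by (auto simp: adjoint_action_mult_right intro!: subspace_sw[OF sub] mult)
  have "subalgebra M"
    unfolding subalgebra_def
  proof (intro conjI ballI M_mult)
    show "subspace M"
      unfolding subspace_def M_def
      by (auto simp: ad subspace_0[OF sub] subspace_add[OF sub] subspace_scale[OF sub])
    show "1 \<in> M"
      by (simp add: M_def adjoint_action_one subspace_scale[OF sub] one)
  qed
  moreover have "commutator a b \<in> M" for a b
  proof -
    have "adjoint_action h (S ?g) = S ?g * plain_commutator ?g h" for h
    proof -
      have "plain_commutator ?g h = ?g * adjoint_action h (S ?g)"
        unfolding plain_commutator_adjoint_right by (rule sw_grouplike[OF l]) (intro lin)+
      then have "S ?g * plain_commutator ?g h = (S ?g * ?g) * adjoint_action h (S ?g)"
        by (simp only: mult.assoc)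
      then show ?thesis
        by (simp add: gS)
    qed
    then have "S ?g \<in> M"
      by (simp add: M_def mult Sg plain)
    moreover have "plain_commutator c d \<in> M" for c d
      by (auto simp: M_def adjoint_plain_commutator intro!: subspace_sw[OF sub] mult plain)
    ultimately show ?thesis
      by (simp add: comm M_mult)
  qed
  ultimately have "?N \<subseteq> M"
    unfolding commutator_subalgebra_def by (intro hull_minimal) auto
  then show ?thesis
    by (auto simp: normal_def M_def)
qed

end

theorem proposition3p3:
  fixes scale :: "'k::field \<Rightarrow> 'h::ring_1 \<Rightarrow> 'h"
    and \<Delta> :: "'h \<Rightarrow> ('h \<times> 'h \<Rightarrow>\<^sub>0 'k) set"
    and \<epsilon> :: "'h \<Rightarrow> 'k"
    and S :: "'h \<Rightarrow> 'h"
  assumes "hopf_algebra scale \<Delta> \<epsilon> S"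
    and "\<exists>B. finite_dimensional_vector_space scale B"
    and "hopf_algebra.unimodular scale \<epsilon>"
  shows "hopf_algebra.normal scale \<Delta> S (hopf_algebra.commutator_subalgebra scale \<Delta> S)"
proof -
  obtain B where "finite_dimensional_vector_space scale B"
    using assms(2) by blast
  with assms(1) have "finite_dimensional_hopf_algebra scale \<Delta> \<epsilon> S B"
    by (simp add: finite_dimensional_hopf_algebra_def)
  then show ?thesis
    using assms(3) by (rule finite_dimensional_hopf_algebra.normal_commutator_subalgebra)
qed

end
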